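(* For every $\epsilon>0$ there is a constant $C_\epsilon$ such that for every integer $\lambda\ge 1$ $$\left|\left\{(\mathbf{x}^1,\mathbf{x}^2,\mathbf{x}^3)\in(\mathbb{Z}^4)^3:\ |\mathbf{x}^i|^2=\lambda \text{ for } 1\le i\le 3,\ |\mathbf{x}^i-\mathbf{x}^j|<\lambda^{1/6}\text{ for } i\neq j\right\}\right|\le C_\epsilon\,\lambda^{1+\epsilon}.$$
   Context: For a vector $\mathbf{x}$, $|\mathbf{x}|$ denotes its Euclidean norm; for a finite set $S$, $|S|$ denotes its cardinality. The constant $C_\epsilon$ depends only on $\epsilon$. *)

theory Defs
  imports "HOL-Analysis.Analysis"
begin

definition int_vectors :: "(real ^ 'n) set" where
  "int_vectors = {x. \<forall>i. x $ i \<in> \<int>}"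

definition close_triples :: "int \<Rightarrow> (real ^ 4 ^ 3) set" where
  "close_triples L =
     {x. (\<forall>i. x $ i \<in> int_vectors) \<and>
         (\<forall>i. (norm (x $ i))\<^sup>2 = of_int L) \<and>
         (\<forall>i j. i \<noteq> j \<longrightarrow> norm (x $ i - x $ j) < of_int L powr (1 / 6))}"

(* card is 0 on infinite sets, so a bound on card (close_triples L) has its intended
   meaning only because of the following fact. *)

lemma finite_vec_components:
  fixes A :: "'a set"
  assumes "finite A"
  shows "finite {x :: 'a ^ 'n. \<forall>i. x $ i \<in> A}"
proof -
  have "finite (PiE (UNIV :: 'n set) (\<lambda>_. A))"
    using assms by (intro finite_PiE) auto
  moreover have "{x :: 'a ^ 'n. \<forall>i. x $ i \<in> A} \<subseteq> vec_lambda ` PiE UNIV (\<lambda>_. A)"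
  proof
    fix x :: "'a ^ 'n" assume "x \<in> {x. \<forall>i. x $ i \<in> A}"
    hence "vec_nth x \<in> PiE UNIV (\<lambda>_. A)" by auto
    moreover have "x = vec_lambda (vec_nth x)" by simp
    ultimately show "x \<in> vec_lambda ` PiE UNIV (\<lambda>_. A)" by blast
  qed
  ultimately show ?thesis by (meson finite_imageI finite_subset)
qed

lemma finite_close_triples: "finite (close_triples L)"
proof -
  define r where "r = sqrt (of_int L)"
  have "finite {k \<in> \<int>. \<bar>k\<bar> \<le> r}" by (rule finite_abs_int_segment)
  hence "finite {y :: real ^ 4. \<forall>j. y $ j \<in> {k \<in> \<int>. \<bar>k\<bar> \<le> r}}"
    by (rule finite_vec_components)
  hence "finite {x :: real ^ 4 ^ 3. \<forall>i. x $ i \<in> {y. \<forall>j. y $ j \<in> {k \<in> \<int>. \<bar>k\<bar> \<le> r}}}"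
    by (rule finite_vec_components)
  moreover have "close_triples L \<subseteq>
      {x. \<forall>i. x $ i \<in> {y. \<forall>j. y $ j \<in> {k \<in> \<int>. \<bar>k\<bar> \<le> r}}}"
  proof
    fix x assume x: "x \<in> close_triples L"
    have "\<bar>x $ i $ j\<bar> \<le> r" for i j
    proof -
      have "norm (x $ i) = r"
        using x unfolding close_triples_def r_def
        by (metis (mono_tags, lifting) mem_Collect_eq norm_ge_zero real_sqrt_unique)
      thus ?thesis using component_le_norm_cart[of "x $ i" j] by simp
    qed
    thus "x \<in> {x. \<forall>i. x $ i \<in> {y. \<forall>j. y $ j \<in> {k \<in> \<int>. \<bar>k\<bar> \<le> r}}}"
      using x unfolding close_triples_def int_vectors_def by auto
  qed
  ultimately show ?thesis by (rule rev_finite_subset)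
qed

end

(* Differences of neighbouring points turn a triple of points of the sphere |x|^2 = L into integer
   quaternions (x, u, v) with 2 x.u = -|u|^2 and 2 x.v = -|v|^2; it suffices to count these for
   distinct nonzero u and v with |u|^6, |v|^6 < L, because n^2 <= 4 + 4 (n - 1) (n - 2).
   The Gram matrix of (x, u, v) is given by k = |u|^2, l = |v|^2 and m = u.v, and it is positive
   definite as k^3, l^3 < L.  Write conj u * v = m + e g with g pure and primitive, and let a be the
   pure part of conj u * x.  The Gram matrix of the pair (g, a) of pure quaternions depends only on
   (k, l, m, e), and two such pairs are conjugate under a primitive integer quaternion q.  The norm N
   of q divides 8 times the Gram determinant, and N divides q * (2 g - r) for a square root r of
   -4 |g|^2 modulo N, where N and r determine q up to boundedly many choices.  As -4 |g|^2 has at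
   most tau(N) s square roots modulo N, where s is the largest integer with s^2 | 16 |g|^2, there are
   O(L^eps s) pairs (g, a).  Finally u is a left divisor of norm k of a known quaternion of content
   gcd(m, e), which leaves O(L^eps gcd(k, m, e)^2) choices for u.
   To sum s gcd(k, m, e)^2 over all k, l <= L^(1/3), put h = gcd(k, m, e), m = h m', e = h e' and
   16 |g|^2 = s^2 t; then 16 k l = h^2 (16 m'^2 + e'^2 s^2 t), so (h, e', s, m', t) determines (k, l)
   up to a divisor bound. *)
theory Submission
  imports Defs "HOL-Computational_Algebra.Primes"
begin

section \<open>Integer quaternions\<close>

text \<open>The exponent 1/6 enters twice. It bounds squared distances by L^(1/3), so that (k, l, m)
  takes only O(L) values and a fibre may contribute just L^eps on average; and it keeps the Gram
  determinant of (x, u, v) positive. The bound for a single fibre can be far larger than L^eps,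
  since s and the gcd may be powers of L. The sum survives because such parameters are rare: fixing
  h, e' and s leaves about L / (h^3 e'^2 s^2) Gram matrices up to a divisor bound, each of weight s
  h^2, and the sum of 1 / (h e'^2 s) is only a power of log L. Left multiplication by conj u leads
  from four dimensions, where a rotation takes two quaternions, to pure quaternions, where it is
  conjugation by one. Integrality then turns conjugation into arithmetic: modulo its norm, a
  primitive intertwiner is an eigenvector of right multiplication, and r is the eigenvalue. Instead
  of dividing by a primitive quaternion, one multiplies it by some y so that the product has real
  part 1; this costs only bounded factors.\<close>

datatype quat = Quat (qre: int) (qi: int) (qj: int) (qk: int)

instantiation quat :: ring_1
begin
definition "0 = Quat 0 0 0 0"
definition "1 = Quat 1 0 0 0"
definition "p + q = Quat (qre p + qre q) (qi p + qi q) (qj p + qj q) (qk p + qk q)"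
definition "p - q = Quat (qre p - qre q) (qi p - qi q) (qj p - qj q) (qk p - qk q)"
definition "- q = Quat (- qre q) (- qi q) (- qj q) (- qk q)"
definition "p * q = Quat
  (qre p * qre q - qi p * qi q - qj p * qj q - qk p * qk q)
  (qre p * qi q + qi p * qre q + qj p * qk q - qk p * qj q)
  (qre p * qj q - qi p * qk q + qj p * qre q + qk p * qi q)
  (qre p * qk q + qi p * qj q - qj p * qi q + qk p * qre q)"
instance
  by standard
    (simp_all add: zero_quat_def one_quat_def plus_quat_def minus_quat_def uminus_quat_def
      times_quat_def algebra_simps)
end

lemma quat_eq_iff: "p = q \<longleftrightarrow> qre p = qre q \<and> qi p = qi q \<and> qj p = qj q \<and> qk p = qk q"
  by (cases p; cases q) auto

lemma quat_sel_arith [simp]: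
  "qre 0 = 0" "qi 0 = 0" "qj 0 = 0" "qk 0 = 0"
  "qre 1 = 1" "qi 1 = 0" "qj 1 = 0" "qk 1 = 0"
  "qre (p + q) = qre p + qre q" "qi (p + q) = qi p + qi q"
  "qj (p + q) = qj p + qj q" "qk (p + q) = qk p + qk q"
  "qre (p - q) = qre p - qre q" "qi (p - q) = qi p - qi q"
  "qj (p - q) = qj p - qj q" "qk (p - q) = qk p - qk q"
  "qre (- q) = - qre q" "qi (- q) = - qi q" "qj (- q) = - qj q" "qk (- q) = - qk q"
  by (simp_all add: zero_quat_def one_quat_def plus_quat_def minus_quat_def uminus_quat_def)

lemma quat_sel_times:
  "qre (p * q) = qre p * qre q - qi p * qi q - qj p * qj q - qk p * qk q"
  "qi (p * q) = qre p * qi q + qi p * qre q + qj p * qk q - qk p * qj q"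
  "qj (p * q) = qre p * qj q - qi p * qk q + qj p * qre q + qk p * qi q"
  "qk (p * q) = qre p * qk q + qi p * qj q - qj p * qi q + qk p * qre q"
  by (simp_all add: times_quat_def)

lemma of_nat_quat: "(of_nat n :: quat) = Quat (int n) 0 0 0"
  by (induction n) (simp_all add: quat_eq_iff)

lemma of_int_quat: "(of_int n :: quat) = Quat n 0 0 0"
  by (cases n rule: int_diff_cases) (simp add: quat_eq_iff of_nat_quat)

lemma quat_sel_of_int [simp]:
  "qre (of_int n) = n" "qi (of_int n) = 0" "qj (of_int n) = 0" "qk (of_int n) = 0"
  by (simp_all add: of_int_quat)

lemma quat_sel_numeral [simp]:
  "qre (numeral w) = numeral w" "qi (numeral w) = 0" "qj (numeral w) = 0" "qk (numeral w) = 0"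
  using quat_sel_of_int[of "numeral w"] by simp_all

lemma quat_sel_scale [simp]:
  "qre (of_int n * q) = n * qre q" "qi (of_int n * q) = n * qi q"
  "qj (of_int n * q) = n * qj q" "qk (of_int n * q) = n * qk q"
  by (simp_all add: quat_sel_times)

lemma quat_scale_cancel: "n \<noteq> 0 \<Longrightarrow> of_int n * p = of_int n * q \<longleftrightarrow> p = (q :: quat)"
  by (simp add: quat_eq_iff)

lemma quat_of_int_commute: "q * of_int n = of_int n * (q :: quat)"
  by (rule mult_of_int_commute[symmetric])

lemma quat_of_int_left_commute: "p * (of_int n * q) = of_int n * (p * q :: quat)"
  by (simp add: quat_eq_iff quat_sel_times algebra_simps)

section \<open>Conjugation, norm, inner product and content\<close>

definition qcnj :: "quat \<Rightarrow> quat" where "qcnj q = Quat (qre q) (- qi q) (- qj q) (- qk q)"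

definition qnorm :: "quat \<Rightarrow> int" where "qnorm q = (qre q)\<^sup>2 + (qi q)\<^sup>2 + (qj q)\<^sup>2 + (qk q)\<^sup>2"

definition qinner :: "quat \<Rightarrow> quat \<Rightarrow> int" where
  "qinner p q = qre p * qre q + qi p * qi q + qj p * qj q + qk p * qk q"

definition qcontent :: "quat \<Rightarrow> int" where
  "qcontent q = gcd (gcd (qre q) (qi q)) (gcd (qj q) (qk q))"

definition qdvd :: "int \<Rightarrow> quat \<Rightarrow> bool" where "qdvd n q \<longleftrightarrow> (\<exists>t. q = of_int n * t)"

lemma qcnj_sel [simp]: "qre (qcnj q) = qre q" "qi (qcnj q) = - qi q" "qj (qcnj q) = - qj q"
  "qk (qcnj q) = - qk q"
  by (simp_all add: qcnj_def)

lemmas quat_components = quat_eq_iff quat_sel_times qnorm_def qinner_def power2_eq_square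

lemma qcnj_mult: "qcnj (p * q) = qcnj q * qcnj p"
  by (simp add: quat_components algebra_simps)

lemma qcnj_qcnj [simp]: "qcnj (qcnj q) = q"
  by (simp add: quat_components)

lemma qnorm_mult: "qnorm (p * q) = qnorm p * qnorm q"
  by (simp add: quat_components algebra_simps)

lemma qnorm_of_int [simp]: "qnorm (of_int n) = n\<^sup>2"
  by (simp add: quat_components)

lemma qnorm_qcnj [simp]: "qnorm (qcnj q) = qnorm q"
  by (simp add: quat_components)

lemma qnorm_nonneg [simp]: "qnorm q \<ge> 0"
  by (simp add: qnorm_def)

lemma qnorm_eq_0 [simp]: "qnorm q = 0 \<longleftrightarrow> q = 0"
  unfolding qnorm_def quat_eq_iff quat_sel_arith
  by (metis (no_types, opaque_lifting) add_nonneg_eq_0_iff add_nonneg_nonneg zero_le_power2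
      zero_eq_power2)

lemma qnorm_0 [simp]: "qnorm 0 = 0"
  by simp

lemma qnorm_pos [simp]: "qnorm q > 0 \<longleftrightarrow> q \<noteq> 0"
  using qnorm_nonneg[of q] qnorm_eq_0[of q] by linarith

lemma mult_qcnj: "q * qcnj q = of_int (qnorm q)" and qcnj_times: "qcnj q * q = of_int (qnorm q)"
  by (simp_all add: quat_components algebra_simps)

lemma add_qcnj: "q + qcnj q = of_int (2 * qre q)"
  by (simp add: quat_eq_iff del: of_int_mult)

text \<open>Replace \<open>q * y\<close> by twice its real part minus its conjugate, and use
  \<open>qcnj q * q = of_int (qnorm q)\<close>. Modulo \<open>qnorm q\<close> the sandwich is thus
  an integer multiple of q, which is the source of the eigenvalues below.\<close>

lemma quat_sandwich: "q * y * q = of_int (2 * qre (q * y)) * q - of_int (qnorm q) * qcnj y"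
  by (simp add: quat_components algebra_simps)

lemma pure_square: "qre a = 0 \<Longrightarrow> a * a = - of_int (qnorm a)"
  by (simp add: quat_components algebra_simps)

lemma qnorm_diff: "qnorm (p - q) = qnorm p + qnorm q - 2 * qinner p q"
  by (simp add: quat_components algebra_simps)

lemma qnorm_add: "qnorm (p + q) = qnorm p + qnorm q + 2 * qinner p q"
  by (simp add: quat_components algebra_simps)

lemma qinner_mult_left: "qinner (p * x) (p * y) = qnorm p * qinner x y"
  by (simp add: quat_components algebra_simps)

lemma qre_qcnj_mult: "qre (qcnj p * q) = qinner p q"
  by (simp add: quat_components)

lemma qinner_commute: "qinner p q = qinner q p"
  by (simp add: quat_components mult.commute)

lemma qdvd_iff: "qdvd n q \<longleftrightarrow> n dvd qre q \<and> n dvd qi q \<and> n dvd qj q \<and> n dvd qk q"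
proof
  assume "n dvd qre q \<and> n dvd qi q \<and> n dvd qj q \<and> n dvd qk q"
  then obtain a b c d where "qre q = n * a" "qi q = n * b" "qj q = n * c" "qk q = n * d"
    by (auto simp: dvd_def)
  then have "q = of_int n * Quat a b c d"
    by (simp add: quat_eq_iff)
  then show "qdvd n q"
    unfolding qdvd_def by blast
qed (auto simp: qdvd_def)

lemma qdvd_add: "qdvd n p \<Longrightarrow> qdvd n q \<Longrightarrow> qdvd n (p + q)"
  and qdvd_diff: "qdvd n p \<Longrightarrow> qdvd n q \<Longrightarrow> qdvd n (p - q)"
  and qdvd_qcnj: "qdvd n p \<Longrightarrow> qdvd n (qcnj p)"
  and qdvd_scale: "qdvd n (of_int n * q)"
  by (simp_all add: qdvd_iff)

lemma qdvd_mult_left: "qdvd n q \<Longrightarrow> qdvd n (p * q)"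
  and qdvd_mult_right: "qdvd n q \<Longrightarrow> qdvd n (q * p)"
  by (simp_all add: qdvd_iff quat_sel_times)

lemma qcontent_dvd: "qdvd (qcontent q) q"
  unfolding qdvd_iff qcontent_def by (meson dvd_trans gcd_dvd1 gcd_dvd2)

lemma qdvd_iff_dvd_content: "qdvd n q \<longleftrightarrow> n dvd qcontent q"
  by (auto simp: qdvd_iff qcontent_def)

lemma qcontent_scale: "qcontent (of_int n * q) = \<bar>n\<bar> * qcontent q"
  by (simp add: qcontent_def flip: gcd_mult_distrib_int)

lemma qcontent_nonneg: "qcontent q \<ge> 0" and qcontent_eq_0: "qcontent q = 0 \<longleftrightarrow> q = 0"
  by (auto simp: qcontent_def quat_eq_iff)

lemma primitive_part:
  assumes "q \<noteq> 0"
  obtains q' where "q = of_int (qcontent q) * q'" "qcontent q' = 1"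
proof -
  obtain q' where q': "q = of_int (qcontent q) * q'"
    using qcontent_dvd[of q] unfolding qdvd_def by blast
  have "qcontent q = qcontent q * qcontent q'"
    by (metis q' qcontent_scale abs_of_nonneg qcontent_nonneg)
  then have "qcontent q' = 1"
    using assms by (simp add: qcontent_eq_0)
  with q' show ?thesis by (rule that)
qed

text \<open>\<open>qre (q * y)\<close> is a linear form in y whose coefficients are those of q up to
  sign, so Bezout applies. For primitive q the resulting y is the substitute for an inverse.\<close>

lemma content_bezout: "\<exists>y. qre (q * y) = qcontent q"
proof -
  obtain a b where ab: "a * qre q + b * qi q = gcd (qre q) (qi q)"
    using bezout_int by blast
  obtain c d where cd: "c * qj q + d * qk q = gcd (qj q) (qk q)"
    using bezout_int by blast
  obtain e f where ef: "e * gcd (qre q) (qi q) + f * gcd (qj q) (qk q) = qcontent q"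
    unfolding qcontent_def using bezout_int by blast
  have "qre (q * Quat (e * a) (- e * b) (- f * c) (- f * d)) = qcontent q"
    unfolding ef[symmetric] ab[symmetric] cd[symmetric]
    by (simp add: quat_sel_times algebra_simps)
  then show ?thesis by blast
qed

text \<open>The left side is the trace of the linear map taking y to a y b, in the basis 1, i, j, k.
  It serves to certify that an explicit linear map is not zero.\<close>

lemma trace_sandwich:
  "qinner (a * b) 1 + qinner (a * Quat 0 1 0 0 * b) (Quat 0 1 0 0)
   + qinner (a * Quat 0 0 1 0 * b) (Quat 0 0 1 0) + qinner (a * Quat 0 0 0 1 * b) (Quat 0 0 0 1)
   = 4 * qre a * qre b"
  by (simp add: quat_components algebra_simps)

section \<open>Counting by fibres and square roots modulo an integer\<close>

text \<open>Finiteness is carried along with each bound, since \<open>card\<close> of an infinite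
  set is 0 and the inequality alone would say nothing.\<close>

lemma card_le_sum_fibers:
  fixes K :: "'b \<Rightarrow> nat"
  assumes "finite B" "f ` A \<subseteq> B"
    and "\<And>b. b \<in> B \<Longrightarrow> finite {a \<in> A. f a = b} \<and> card {a \<in> A. f a = b} \<le> K b"
  shows "finite A" "card A \<le> (\<Sum>b\<in>B. K b)"
proof -
  have A: "A = (\<Union>b\<in>B. {a \<in> A. f a = b})"
    using assms(2) by auto
  show "finite A"
    by (subst A) (use assms in blast)
  have "card A \<le> (\<Sum>b\<in>B. card {a \<in> A. f a = b})"
    by (subst A) (rule card_UN_le[OF assms(1)])
  also have "\<dots> \<le> (\<Sum>b\<in>B. K b)"
    by (rule sum_mono) (use assms(3) in blast)
  finally show "card A \<le> (\<Sum>b\<in>B. K b)" .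
qed

lemma card_le_mult_fibers:
  fixes K :: nat
  assumes "finite B" "f ` A \<subseteq> B"
    and "\<And>b. b \<in> B \<Longrightarrow> finite {a \<in> A. f a = b} \<and> card {a \<in> A. f a = b} \<le> K"
  shows "finite A" "card A \<le> card B * K"
  using card_le_sum_fibers[OF assms(1,2), of "\<lambda>_. K"] assms(3) by auto

definition pos_divisors :: "int \<Rightarrow> int set" where "pos_divisors n = {d. 0 < d \<and> d dvd n}"

lemma finite_pos_divisors: "n \<noteq> 0 \<Longrightarrow> finite (pos_divisors n)"
  unfolding pos_divisors_def by (rule finite_subset[of _ "{d. d dvd n}"]) auto

lemma int_div_less_bound: "0 < h \<Longrightarrow> r < g * h \<Longrightarrow> r div h < (g :: int)"
  by (smt (verit) mult_right_mono pos_mod_sign mult_div_mod_eq mult.commute)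

lemma card_square_roots_mod:
  fixes N a :: int and S :: nat
  assumes "N > 0" and S: "\<And>g. g > 0 \<Longrightarrow> g\<^sup>2 dvd 4 * a \<Longrightarrow> g \<le> int S"
  shows "card {r \<in> {0..<N}. N dvd r\<^sup>2 + a} \<le> card (pos_divisors N) * S"
proof (cases "{r \<in> {0..<N}. N dvd r\<^sup>2 + a} = {}")
  case False
  define X where "X = {r \<in> {0..<N}. N dvd r\<^sup>2 + a}"
  obtain r0 where r0: "r0 \<in> X"
    using False unfolding X_def by blast
  \<comment> \<open>N div d r divides r + r0, so r is determined by d r up to gcd (d r) (N div d r) choices,
    and the square of this gcd divides 4 * a.\<close>
  define d where "d r = gcd (r - r0) N" for r
  have d_pos: "d r > 0" and d_dvd: "d r dvd N" for r
    using \<open>N > 0\<close> unfolding d_def by auto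
  have cof: "N div d r dvd r + r0" if "r \<in> X" for r
  proof -
    have "N dvd (r\<^sup>2 + a) - (r0\<^sup>2 + a)"
      using that r0 unfolding X_def by (intro dvd_diff) auto
    then have "N dvd (r - r0) * (r + r0)"
      by (simp add: power2_eq_square algebra_simps)
    then have "d r * (N div d r) dvd d r * ((r - r0) div d r * (r + r0))"
      by (simp add: d_def mult.assoc[symmetric])
    then have "N div d r dvd (r - r0) div d r * (r + r0)"
      using d_pos[of r] by (subst (asm) dvd_times_left_cancel_iff) auto
    moreover have "coprime (N div d r) ((r - r0) div d r)"
      unfolding d_def using \<open>N > 0\<close>
      by (metis coprime_commute div_gcd_coprime less_irrefl)
    ultimately show ?thesis
      by (simp add: coprime_dvd_mult_right_iff)
  qed
  have fib: "finite {r \<in> X. d r = e} \<and> card {r \<in> X. d r = e} \<le> S" if e: "e \<in> pos_divisors N" for e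
  proof (cases "{r \<in> X. d r = e} = {}")
    case nonempty: False
    then obtain r1 where r1: "r1 \<in> X" "d r1 = e" by blast
    define g where "g = gcd e (N div e)"
    have e0: "e > 0" "e dvd N"
      using e by (auto simp: pos_divisors_def)
    have g: "g > 0"
      using e0 by (auto simp: g_def)
    \<comment> \<open>Subtracting shows that g divides 2 r0; as g^2 also divides N and hence r0^2 +
      a, the square of r0 can be eliminated.\<close>
    have "g dvd r1 + r0" "g dvd r1 - r0"
      using r1 cof[OF r1(1)] unfolding g_def d_def by (auto intro: dvd_trans)
    then have "g dvd (r1 + r0) - (r1 - r0)"
      by (rule dvd_diff)
    then have "g\<^sup>2 dvd (2 * r0)\<^sup>2"
      by (intro dvd_power_same) simp
    moreover have "g * g dvd e * (N div e)"
      unfolding g_def by (intro mult_dvd_mono) auto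
    then have "g\<^sup>2 dvd N"
      using e0 by (simp add: power2_eq_square)
    then have "g\<^sup>2 dvd 4 * (r0\<^sup>2 + a)"
      using r0 unfolding X_def by (intro dvd_mult) (auto intro: dvd_trans)
    ultimately have "g\<^sup>2 dvd 4 * (r0\<^sup>2 + a) - (2 * r0)\<^sup>2"
      by (intro dvd_diff)
    then have "g\<^sup>2 dvd 4 * a"
      by (simp add: power2_eq_square algebra_simps)
    then have gS: "g \<le> int S"
      using S g by blast
    \<comment> \<open>All r of the fibre agree with r0 modulo e and with -r0 modulo
      \<open>N div e\<close>, hence with each other modulo h. So \<open>r div h\<close> identifies
      r, and as N = g h it takes at most g values.\<close>
    define h where "h = lcm e (N div e)"
    have Nh: "N = g * h"
      using e0 \<open>N > 0\<close> unfolding g_def h_def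
      by (simp add: prod_gcd_lcm_int[symmetric] abs_of_pos pos_imp_zdiv_nonneg_iff)
    have h: "h > 0"
      using Nh g \<open>N > 0\<close> by (simp add: zero_less_mult_iff)
    have inj: "inj_on (\<lambda>r. r div h) {r \<in> X. d r = e}"
    proof (rule inj_onI)
      fix r s assume rs: "r \<in> {r \<in> X. d r = e}" "s \<in> {r \<in> X. d r = e}" "r div h = s div h"
      have "e dvd r - r0" "e dvd s - r0"
        using rs(1,2) gcd_dvd1[of "r - r0" N] gcd_dvd1[of "s - r0" N] unfolding d_def by simp_all
      then have "e dvd (r - r0) - (s - r0)"
        by (rule dvd_diff)
      moreover have "N div e dvd r + r0" "N div e dvd s + r0"
        using rs(1,2) cof[of r] cof[of s] by auto
      then have "N div e dvd (r + r0) - (s + r0)"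
        by (rule dvd_diff)
      ultimately have "h dvd r - s"
        unfolding h_def by (intro lcm_least) simp_all
      then have "r mod h = s mod h"
        by (simp add: mod_eq_dvd_iff)
      then show "r = s"
        using rs(3) by (metis mult_div_mod_eq)
    qed
    have "(\<lambda>r. r div h) ` {r \<in> X. d r = e} \<subseteq> {0..<g}"
    proof safe
      fix r assume "r \<in> X"
      then have r: "0 \<le> r" "r < g * h"
        using Nh by (auto simp: X_def)
      then show "r div h \<in> {0..<g}"
        using h by (auto simp: pos_imp_zdiv_nonneg_iff intro: int_div_less_bound)
    qed
    then have "card ((\<lambda>r. r div h) ` {r \<in> X. d r = e}) \<le> card {0..<g}"
      by (intro card_mono) auto
    moreover have "finite {r \<in> X. d r = e}"
      unfolding X_def by (rule finite_subset[of _ "{0..<N}"]) auto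
    ultimately show ?thesis
      using gS inj by (simp add: card_image)
  next
    case True
    show ?thesis
      unfolding True by simp
  qed
  have "d ` X \<subseteq> pos_divisors N"
    using d_pos d_dvd by (auto simp: pos_divisors_def)
  then show ?thesis
    using card_le_mult_fibers(2)[OF finite_pos_divisors, of N d X S] fib \<open>N > 0\<close>
    unfolding X_def by auto
next
  case True
  show ?thesis
    unfolding True by simp
qed

section \<open>Quaternions of given norm\<close>

lemma finite_qnorm: "finite {q. qnorm q = n}"
  and card_qnorm_16: "card {q. qnorm q = 16} \<le> 6561"
proof -
  have sub: "{q. qnorm q = n} \<subseteq>
      (\<lambda>(a, b, c, d). Quat a b c d) ` ({-m..m} \<times> {-m..m} \<times> {-m..m} \<times> {-m..m})"
    if m: "n \<le> m\<^sup>2" "m \<ge> 0" for n m :: int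
  proof
    fix q assume q: "q \<in> {q. qnorm q = n}"
    have "(qre q)\<^sup>2 \<le> m\<^sup>2" "(qi q)\<^sup>2 \<le> m\<^sup>2" "(qj q)\<^sup>2 \<le> m\<^sup>2" "(qk q)\<^sup>2 \<le> m\<^sup>2"
      using q m zero_le_power2[of "qre q"] zero_le_power2[of "qi q"] zero_le_power2[of "qj q"]
        zero_le_power2[of "qk q"]
      unfolding qnorm_def mem_Collect_eq by linarith+
    then have "\<bar>qre q\<bar> \<le> m" "\<bar>qi q\<bar> \<le> m" "\<bar>qj q\<bar> \<le> m" "\<bar>qk q\<bar> \<le> m"
      using \<open>m \<ge> 0\<close> by (simp_all add: abs_le_square_iff[symmetric])
    then show "q \<in> (\<lambda>(a, b, c, d). Quat a b c d) ` ({-m..m} \<times> {-m..m} \<times> {-m..m} \<times> {-m..m})"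
      by (intro image_eqI[of _ _ "(qre q, qi q, qj q, qk q)"]) auto
  qed
  show "finite {q. qnorm q = n}"
  proof (cases "n \<ge> 0")
    case True
    then have "n \<le> n\<^sup>2"
      using self_le_power[of n 2] by (cases "n = 0") auto
    from sub[OF this True] show ?thesis
      by (rule finite_subset) auto
  next
    case False
    then have "{q. qnorm q = n} = {}"
      using qnorm_nonneg by auto
    then show ?thesis by simp
  qed
  \<comment> \<open>Four coefficients between -4 and 4 give 9^4 = 6561, the constant that recurs in
    the later bounds.\<close>
  have "card {q. qnorm q = 16} \<le> card ({-4..4::int} \<times> {-4..4::int} \<times> {-4..4::int} \<times> {-4..4::int})"
    using sub[of 16 4] by (intro surj_card_le[of _ _ "\<lambda>(a, b, c, d). Quat a b c d"]) auto
  then show "card {q. qnorm q = 16} \<le> 6561"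
    by (simp add: card_cartesian_product)
qed

section \<open>Intertwiners\<close>

text \<open>With \<open>qre (q * y) = 1\<close> the sandwich identity gives 2 q = q y q modulo
  \<open>qnorm q\<close>. Moving \<open>a\<close> through q turns a (2 q) into q (a0 y) q, again an
  integer multiple of q. So right multiplication by 2 a0 acts on q as a scalar modulo
  \<open>qnorm q\<close>, and r is that scalar.\<close>

lemma primitive_intertwiner_root:
  assumes q: "qcontent q = 1" and int: "q * a0 = a * q"
  obtains r where "qdvd (qnorm q) (q * (2 * a0 - of_int r))" "0 \<le> r" "r < qnorm q"
proof -
  define N where "N = qnorm q"
  have "q \<noteq> 0"
    using q by (auto simp: qcontent_def)
  then have N: "N > 0"
    by (simp add: N_def)
  obtain y where y: "qre (q * y) = 1"
    using content_bezout[of q] q by auto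
  define z where "z = a0 * y"
  define r where "r = (2 * qre (q * z)) mod N"
  have "q * y * q = 2 * q - of_int N * qcnj y"
    using quat_sandwich[of q y] y by (simp add: N_def)
  then have "2 * q = q * y * q + of_int N * qcnj y"
    by simp
  then have "a * (2 * q) = a * q * y * q + a * (of_int N * qcnj y)"
    by (simp add: distrib_left mult.assoc)
  also have "a * q * y * q = q * z * q"
    by (simp add: z_def int[symmetric] mult.assoc)
  also have "\<dots> = of_int (2 * qre (q * z)) * q - of_int N * qcnj z"
    using quat_sandwich[of q z] by (simp add: N_def)
  also have "a * (2 * q) = q * (2 * a0)"
    using int by (simp add: quat_eq_iff quat_sel_times)
  finally have *: "q * (2 * a0) = of_int (2 * qre (q * z)) * q - of_int N * qcnj z
    + of_int N * (a * qcnj y)"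
    by (simp add: quat_of_int_left_commute)
  define m where "m = 2 * qre (q * z)"
  define d where "d = m div N"
  have m: "m = r + N * d"
    unfolding r_def d_def m_def by simp
  have "q * (2 * a0 - of_int r) = q * (2 * a0) - of_int r * q"
    by (simp add: right_diff_distrib quat_of_int_commute)
  also have "\<dots> = of_int N * (of_int d * q - qcnj z + a * qcnj y)"
    unfolding * m_def[symmetric] m by (simp add: distrib_left distrib_right right_diff_distrib mult.assoc)
  finally have "qdvd N (q * (2 * a0 - of_int r))"
    by (simp only: qdvd_scale)
  moreover have "0 \<le> r" "r < N"
    unfolding r_def using N by simp_all
  ultimately show ?thesis
    using that unfolding N_def by blast
qed

lemma qdvd_primitive:
  assumes "qcontent q = 1" "qdvd n (of_int m * q)"
  shows "n dvd m"
  using assms by (simp add: qdvd_iff_dvd_content qcontent_scale)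

text \<open>As a0 is pure, (2 a0 - r) (2 a0 + r) is the integer -(r^2 + 4 |a0|^2), and primitivity
  of q passes divisibility from its product with q to the integer itself.\<close>

lemma root_square:
  assumes "qcontent q = 1" "qre a0 = 0" "qdvd N (q * (2 * a0 - of_int r))"
  shows "N dvd r\<^sup>2 + 4 * qnorm a0"
proof -
  have "qdvd N (q * (2 * a0 - of_int r) * (2 * a0 + of_int r))"
    by (intro qdvd_mult_right assms)
  also have "q * (2 * a0 - of_int r) * (2 * a0 + of_int r)
      = q * ((2 * a0 - of_int r) * (2 * a0 + of_int r))"
    by (rule mult.assoc)
  also have "(2 * a0 - of_int r) * (2 * a0 + of_int r) = of_int (- (r\<^sup>2 + 4 * qnorm a0))"
    using assms(2) by (simp add: quat_components algebra_simps
        del: of_int_add of_int_mult of_int_minus of_int_power of_int_diff)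
  also have "q * of_int (- (r\<^sup>2 + 4 * qnorm a0)) = of_int (- (r\<^sup>2 + 4 * qnorm a0)) * q"
    by (rule quat_of_int_commute)
  finally have "N dvd - (r\<^sup>2 + 4 * qnorm a0)"
    by (rule qdvd_primitive[OF assms(1)])
  then show ?thesis
    by (simp only: dvd_minus_iff)
qed

text \<open>For p and q with the same root, p b and q b both vanish modulo N, where b = 2 a0 - r.
  Inserting 4 = b y + conj (b y) between p and conj q makes 4 p conj q divisible by N; the quotient
  has norm 16 and determines p once q is fixed.\<close>

lemma same_root_fiber:
  fixes r :: int
  assumes a0: "qcontent a0 = 1" "qre a0 = 0" and N: "N > 0"
  defines "X \<equiv> {q. qnorm q = N \<and> qdvd N (q * (2 * a0 - of_int r))}"
  shows "finite X \<and> card X \<le> 6561"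
proof (cases "X = {}")
  case False
  then obtain q where q: "q \<in> X" by blast
  define b where "b = 2 * a0 - of_int r"
  obtain y0 where y0: "qre (a0 * y0) = 1"
    using content_bezout[of a0] a0 by auto
  \<comment> \<open>Making y pure keeps \<open>qre (a0 * y) = 1\<close>, because a0 is pure, and
    removes r from \<open>qre (b * y)\<close>.\<close>
  define y where "y = y0 - of_int (qre y0)"
  have "qre (b * y) = 2"
    using y0 a0 by (simp add: b_def y_def quat_sel_times)
  then have b: "b * y + qcnj y * qcnj b = 4"
    using add_qcnj[of "b * y"] by (simp add: qcnj_mult)
  have ex: "\<exists>t. 4 * (p * qcnj q) = of_int N * t" if "p \<in> X" for p
  proof -
    have "4 * (p * qcnj q) = p * (b * y + qcnj y * qcnj b) * qcnj q"
      unfolding b by (simp add: quat_eq_iff quat_sel_times)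
    also have "\<dots> = (p * b) * (y * qcnj q) + (p * qcnj y) * qcnj (q * b)"
      by (simp add: distrib_left distrib_right qcnj_mult mult.assoc)
    finally have eq: "4 * (p * qcnj q) = \<dots>" .
    have "qdvd N (p * b)" "qdvd N (q * b)"
      using that q by (auto simp: X_def b_def)
    then have "qdvd N (4 * (p * qcnj q))"
      unfolding eq by (blast intro: qdvd_add qdvd_mult_left qdvd_mult_right qdvd_qcnj)
    then show ?thesis
      by (simp add: qdvd_def)
  qed
  then obtain t where t: "4 * (p * qcnj q) = of_int N * t p" if "p \<in> X" for p
    by metis
  have "inj_on t X"
  proof (rule inj_onI)
    fix p p' assume p: "p \<in> X" "p' \<in> X" "t p = t p'"
    then have "of_int 4 * (p * qcnj q) = of_int 4 * (p' * qcnj q)"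
      using t by (metis of_int_numeral)
    then have "p * qcnj q * q = p' * qcnj q * q"
      by (simp only: quat_scale_cancel[of 4])
    then have "of_int N * p = of_int N * p'"
      using q by (simp add: mult.assoc qcnj_times X_def quat_of_int_commute)
    then show "p = p'"
      using N by (subst (asm) quat_scale_cancel) auto
  qed
  moreover have "t ` X \<subseteq> {q. qnorm q = 16}"
  proof safe
    fix p assume p: "p \<in> X"
    have "qnorm (of_int 4 * (p * qcnj q)) = qnorm (of_int N * t p)"
      using t[OF p] by simp
    then have "16 * (N * N) = N * N * qnorm (t p)"
      using p q unfolding qnorm_mult qnorm_of_int by (simp add: X_def power2_eq_square)
    then show "qnorm (t p) = 16"
      using N by simp
  qed
  ultimately show ?thesis
    using card_inj_on_le[of t X] inj_on_finite[of t X] finite_qnorm[of 16] card_qnorm_16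
    by (meson order_trans)
qed auto

lemma card_primitive_intertwiners:
  assumes a0: "qcontent a0 = 1" "qre a0 = 0" and N: "N > 0"
    and S: "\<And>g. g > 0 \<Longrightarrow> g\<^sup>2 dvd 16 * qnorm a0 \<Longrightarrow> g \<le> int S"
  defines "Q \<equiv> {q. qcontent q = 1 \<and> qnorm q = N \<and> (\<exists>a. q * a0 = a * q)}"
  shows "finite Q" "card Q \<le> card (pos_divisors N) * S * 6561"
proof -
  have "\<exists>r. qdvd N (q * (2 * a0 - of_int r)) \<and> 0 \<le> r \<and> r < N" if "q \<in> Q" for q
    using that primitive_intertwiner_root[of q a0] unfolding Q_def by blast
  then obtain r where r: "qdvd N (q * (2 * a0 - of_int (r q))) \<and> 0 \<le> r q \<and> r q < N"
    if "q \<in> Q" for q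
    by metis
  define R where "R = {r \<in> {0..<N}. N dvd r\<^sup>2 + 4 * qnorm a0}"
  have sub: "r ` Q \<subseteq> R"
  proof safe
    fix q assume q: "q \<in> Q"
    then have "N dvd (r q)\<^sup>2 + 4 * qnorm a0"
      using root_square[of q, OF _ a0(2)] r[OF q] by (simp add: Q_def)
    then show "r q \<in> R"
      using r[OF q] by (simp add: R_def)
  qed
  have finR: "finite R"
    unfolding R_def by (rule finite_subset[of _ "{0..<N}"]) auto
  have fib: "finite {q \<in> Q. r q = s} \<and> card {q \<in> Q. r q = s} \<le> 6561" for s
  proof -
    have "{q \<in> Q. r q = s} \<subseteq> {q. qnorm q = N \<and> qdvd N (q * (2 * a0 - of_int s))}"
      using r by (auto simp: Q_def)
    then show ?thesis
      using same_root_fiber[OF a0 N, of s] by (meson card_mono finite_subset order_trans)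
  qed
  note fin = card_le_mult_fibers(1)[OF finR sub fib] and le = card_le_mult_fibers(2)[OF finR sub fib]
  \<comment> \<open>The roots are those of -4 |a0|^2, so the 4 in
    \<open>card_square_roots_mod\<close> becomes the 16 in the hypothesis on S.\<close>
  have S': "g \<le> int S" if g: "g > 0" "g\<^sup>2 dvd 4 * (4 * qnorm a0)" for g
  proof -
    have "4 * (4 * qnorm a0) = 16 * qnorm a0"
      by simp
    with g show "g \<le> int S"
      using S[of g] by metis
  qed
  have R: "card R \<le> card (pos_divisors N) * S"
    unfolding R_def by (rule card_square_roots_mod[OF N S'])
  show "finite Q" "card Q \<le> card (pos_divisors N) * S * 6561"
    using fin order_trans[OF le mult_le_mono1[OF R]] .
qed

text \<open>Equal Gram matrices mean that a rotation carries (a0, b0) to (a, b), and rotations are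
  conjugations by quaternions. An integral one comes from averaging: taking y to a^-1 y a0 is an
  involution whose fixed points are the q with q a0 = a q. Any y with nonzero average will do, and
  removing the content makes the result primitive.\<close>

lemma exists_intertwiner:
  assumes pure: "qre a = 0" "qre b = 0" "qre a0 = 0" "qre b0 = 0"
    and gram: "qnorm a = A" "qnorm a0 = A" "qinner a b = C" "qinner a0 b0 = C"
      "qnorm b = B" "qnorm b0 = B"
    and A: "A > 0" and D: "A * B - C\<^sup>2 > 0"
  obtains q where "qcontent q = 1" "q * a0 = a * q" "q * b0 = b * q"
proof -
  define D where "D = A * B - C\<^sup>2"
  \<comment> \<open>n is the cross product of a and b. Unlike b, it always anticommutes with a, so
    that the averages over (a, a0) and (n, n0) are compatible; b is recovered from A b = C a - a
    n.\<close>
  define n n0 where "n = a * b + of_int C" and "n0 = a0 * b0 + of_int C"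
  have D0: "D \<noteq> 0" "A \<noteq> 0"
    using A D by (auto simp: D_def)
  have sq: "x * x = - of_int A" if "x = a \<or> x = a0" for x
    using that pure_square gram pure by auto
  have anti: "(x * y + of_int C) * x = - (x * (x * y + of_int C))"
    "qre (x * y + of_int C) = 0" "(x * y + of_int C) * (x * y + of_int C) = - of_int D"
    "qre ((x * y + of_int C) * x) = 0"
    if "qre x = 0" "qre y = 0" "qnorm x = A" "qinner x y = C" "qnorm y = B" for x y
  proof -
    have "y * x + x * y = - of_int C - of_int C"
      using that by (simp add: quat_components)
    then have yx: "y * x = - of_int C - of_int C - x * y"
      by (simp add: algebra_simps)
    have "(x * y + of_int C) * x = x * (y * x) + of_int C * x"
      by (simp add: distrib_right mult.assoc)
    also have "\<dots> = - (x * (x * y)) - of_int C * x"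
      unfolding yx by (simp add: right_diff_distrib quat_of_int_commute)
    finally have nx: "(x * y + of_int C) * x = \<dots>" .
    show 1: "(x * y + of_int C) * x = - (x * (x * y + of_int C))"
      unfolding nx by (simp add: distrib_left quat_of_int_commute)
    show 2: "qre (x * y + of_int C) = 0"
      using that by (simp add: quat_components)
    have "x * (x * y) = - of_int A * y"
      using pure_square[OF that(1)] that(3) by (simp add: mult.assoc[symmetric])
    then show "qre ((x * y + of_int C) * x) = 0"
      unfolding nx using that by simp
    have "qnorm (x * y + of_int C) = qnorm (x * y) + C\<^sup>2 + 2 * (C * qre (x * y))"
      by (simp add: qnorm_add qinner_def)
    also have "qre (x * y) = - C"
      using that by (simp add: quat_components)
    finally have "qnorm (x * y + of_int C) = D"
      using that by (simp add: qnorm_mult D_def power2_eq_square)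
    then show "(x * y + of_int C) * (x * y + of_int C) = - of_int D"
      using pure_square[OF 2] by simp
  qed
  note n = anti[OF pure(1,2) gram(1,3,5), folded n_def]
  note n0 = anti[OF pure(3,4) gram(2,4,6), folded n0_def]
  have Ab: "of_int A * b = of_int C * a - a * n"
    unfolding n_def using sq[of a]
    by (simp add: distrib_left mult.assoc[symmetric] quat_of_int_commute)
  have Ab0: "of_int A * b0 = of_int C * a0 - a0 * n0"
    unfolding n0_def using sq[of a0]
    by (simp add: distrib_left mult.assoc[symmetric] quat_of_int_commute)
  \<comment> \<open>The two averages are scaled by A and D, the norms of a and n, to stay integral:
    a^-1 = -a / A and n^-1 = -n / D.\<close>
  define w where "w y = of_int A * y - a * y * a0" for y
  define q where "q y = of_int D * w y - n * w y * n0" for y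
  have w: "w y * a0 = a * w y" for y
  proof -
    have "w y * a0 = of_int A * y * a0 - a * y * (a0 * a0)"
      by (simp add: w_def left_diff_distrib mult.assoc)
    also have "\<dots> = of_int A * y * a0 + of_int A * (a * y)"
      by (simp add: sq quat_of_int_commute)
    also have "\<dots> = a * (of_int A * y) - (a * a) * y * a0"
      by (simp add: sq quat_of_int_left_commute mult.assoc)
    also have "\<dots> = a * w y"
      by (simp add: w_def right_diff_distrib mult.assoc)
    finally show ?thesis .
  qed
  have qa: "q y * a0 = a * q y" for y
  proof -
    have "q y * a0 = of_int D * (w y * a0) - n * w y * (n0 * a0)"
      by (simp add: q_def left_diff_distrib mult.assoc)
    also have "\<dots> = of_int D * (w y * a0) + n * (w y * a0) * n0"
      by (simp add: n0 mult.assoc)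
    also have "\<dots> = a * (of_int D * w y) + (n * a) * w y * n0"
      by (simp add: w quat_of_int_left_commute mult.assoc)
    also have "\<dots> = a * q y"
      by (simp add: n q_def right_diff_distrib mult.assoc)
    finally show ?thesis .
  qed
  have qn: "q y * n0 = n * q y" for y
  proof -
    have "q y * n0 = of_int D * w y * n0 - n * w y * (n0 * n0)"
      by (simp add: q_def left_diff_distrib mult.assoc)
    also have "\<dots> = of_int D * w y * n0 + n * (of_int D * w y)"
      by (simp add: n0 quat_of_int_commute quat_of_int_left_commute mult.assoc)
    also have "\<dots> = n * (of_int D * w y) - (n * n) * w y * n0"
      by (simp add: n mult.assoc)
    also have "\<dots> = n * q y"
      by (simp add: q_def right_diff_distrib mult.assoc)
    finally show ?thesis .
  qed
  have qb: "q y * b0 = b * q y" for y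
  proof -
    have "of_int A * (q y * b0) = q y * (of_int A * b0)"
      by (simp add: quat_of_int_left_commute)
    also have "\<dots> = of_int C * (q y * a0) - (q y * a0) * n0"
      by (simp add: Ab0 right_diff_distrib quat_of_int_left_commute mult.assoc)
    also have "\<dots> = of_int C * (a * q y) - a * (q y * n0)"
      by (simp add: qa mult.assoc)
    also have "\<dots> = (of_int C * a - a * n) * q y"
      by (simp add: qn left_diff_distrib mult.assoc)
    also have "\<dots> = of_int A * (b * q y)"
      by (simp add: Ab[symmetric] mult.assoc)
    finally show ?thesis
      using D0 by (simp add: quat_scale_cancel)
  qed
  let ?i = "Quat 0 1 0 0" and ?j = "Quat 0 0 1 0" and ?k = "Quat 0 0 0 1"
  \<comment> \<open>The map q is linear and nonzero, because its trace is 4 D A.\<close>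
  have q_exp: "q y = of_int (D * A) * y * 1 - of_int D * a * y * a0 - of_int A * n * y * n0
      + (n * a) * y * (a0 * n0)" for y
    by (simp add: q_def w_def right_diff_distrib left_diff_distrib mult.assoc
        quat_of_int_left_commute[of n])
  have lin: "qinner (x - y - z + u) e = qinner x e - qinner y e - qinner z e + qinner u e" for x y z u e
    by (simp add: qinner_def algebra_simps)
  have "qinner (q 1) 1 + qinner (q ?i) ?i + qinner (q ?j) ?j + qinner (q ?k) ?k = 4 * (D * A)"
    unfolding q_exp lin
    using trace_sandwich[of "of_int (D * A)" 1] trace_sandwich[of "of_int D * a" a0]
      trace_sandwich[of "of_int A * n" n0] trace_sandwich[of "n * a" "a0 * n0"] pure n n0
    by simp
  moreover have "qinner 0 z = 0" for z
    by (simp add: qinner_def)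
  ultimately have "\<not> (\<forall>y. q y = 0)"
    using D0 by fastforce
  then obtain y where y: "q y \<noteq> 0" by blast
  obtain p where p: "q y = of_int (qcontent (q y)) * p" "qcontent p = 1"
    using primitive_part[OF y] by blast
  define c where "c = qcontent (q y)"
  have c: "c \<noteq> 0" "q y = of_int c * p"
    using y p by (auto simp: c_def qcontent_eq_0)
  have "p * a0 = a * p"
    using qa[of y] c by (simp add: c(2) mult.assoc quat_of_int_left_commute quat_scale_cancel)
  moreover have "p * b0 = b * p"
    using qb[of y] c by (simp add: c(2) mult.assoc quat_of_int_left_commute quat_scale_cancel)
  ultimately show ?thesis
    using that p(2) by blast
qed

text \<open>Modulo \<open>qnorm q\<close>, right multiplications by 2 a0 and by 2 b0 act on q as
  scalars, which commute. Hence the commutator of 2 a0 and 2 b0, which is 8 times their cross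
  product n0, annihilates q. Another factor n0 turns 8 n0 into the integer -8 D, and primitivity of
  q applies.\<close>

lemma intertwiner_norm_dvd:
  assumes q: "qcontent q = 1" "q * a0 = a * q" "q * b0 = b * q"
    and pure: "qre a0 = 0" "qre b0 = 0"
  shows "qnorm q dvd 8 * (qnorm a0 * qnorm b0 - (qinner a0 b0)\<^sup>2)"
proof -
  define N where "N = qnorm q"
  define D where "D = qnorm a0 * qnorm b0 - (qinner a0 b0)\<^sup>2"
  define n0 where "n0 = a0 * b0 + of_int (qinner a0 b0)"
  obtain r where r: "qdvd N (q * (2 * a0 - of_int r))"
    using primitive_intertwiner_root[OF q(1,2)] unfolding N_def by blast
  obtain s where s: "qdvd N (q * (2 * b0 - of_int s))"
    using primitive_intertwiner_root[OF q(1,3)] unfolding N_def by blast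
  have eq: "q * (8 * n0) = q * (2 * a0 - of_int r) * (2 * b0 + of_int s)
      - q * (2 * b0 - of_int s) * (2 * a0 + of_int r)
      + of_int 2 * (of_int r * (q * (2 * b0 - of_int s)) - of_int s * (q * (2 * a0 - of_int r)))"
  proof -
    have "8 * n0 = 4 * (a0 * b0 - b0 * a0)"
      using pure by (simp add: n0_def quat_components)
    also have "\<dots> = (2 * a0 - of_int r) * (2 * b0 + of_int s)
      - (2 * b0 - of_int s) * (2 * a0 + of_int r)
      + of_int 2 * (of_int r * (2 * b0 - of_int s) - of_int s * (2 * a0 - of_int r))"
      by (simp add: quat_eq_iff quat_sel_times algebra_simps)
    finally have e8: "8 * n0 = \<dots>" .
    have "q * (X * Y' - Y * X' + of_int 2 * (of_int r * Y - of_int s * X))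
      = q * X * Y' - q * Y * X' + of_int 2 * (of_int r * (q * Y) - of_int s * (q * X))" for X Y X' Y'
      by (simp only: distrib_left right_diff_distrib mult.assoc quat_of_int_left_commute[of q])
    then show ?thesis
      unfolding e8 .
  qed
  have "qdvd N (q * (8 * n0))"
    unfolding eq using r s by (blast intro: qdvd_add qdvd_diff qdvd_mult_right qdvd_mult_left)
  then have *: "qdvd N (q * (8 * n0) * n0)"
    by (rule qdvd_mult_right)
  have "qre n0 = 0"
    using pure by (simp add: n0_def quat_components)
  then have sq: "n0 * n0 = - of_int (qnorm n0)"
    by (rule pure_square)
  have "qnorm n0 = D"
    using pure by (simp add: n0_def D_def quat_components algebra_simps)
  then have "q * (8 * n0) * n0 = q * of_int (- (8 * D))"
    using sq by (simp add: mult.assoc)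
  also have "\<dots> = of_int (- (8 * D)) * q"
    by (rule quat_of_int_commute)
  finally have "qdvd N (of_int (- (8 * D)) * q)"
    using * by (simp only:)
  then have "N dvd - (8 * D)"
    by (rule qdvd_primitive[OF q(1)])
  then show ?thesis
    by (simp only: N_def D_def dvd_minus_iff)
qed

section \<open>Counting pairs of pure quaternions and divisors of a quaternion\<close>

text \<open>Each pair is replaced by an intertwiner q with one fixed pair (a0, b0); it is recovered
  by cancelling q on the right in q a0 = a q and q b0 = b q. One factor T counts the norms of q, the
  other belongs to the square roots modulo the norm.\<close>

lemma card_pure_pairs:
  fixes T S :: nat
  assumes A: "A > 0" and D: "A * B - C\<^sup>2 > 0"
    and T: "\<And>n. 0 < n \<Longrightarrow> n \<le> 8 * (A * B - C\<^sup>2) \<Longrightarrow> card (pos_divisors n) \<le> T"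
    and S: "\<And>g. g > 0 \<Longrightarrow> g\<^sup>2 dvd 16 * A \<Longrightarrow> g \<le> int S"
  defines "F \<equiv> {(a, b). qre a = 0 \<and> qre b = 0 \<and> qcontent a = 1 \<and>
    qnorm a = A \<and> qinner a b = C \<and> qnorm b = B}"
  shows "finite F \<and> card F \<le> T * (T * S * 6561)"
proof (cases "F = {}")
  case False
  then obtain a0 b0 where ab0: "(a0, b0) \<in> F" by auto
  then have pure0: "qre a0 = 0" "qre b0 = 0" and cont0: "qcontent a0 = 1" and
    gram0: "qnorm a0 = A" "qinner a0 b0 = C" "qnorm b0 = B"
    by (simp_all add: F_def)
  define D where "D = A * B - C\<^sup>2"
  have "\<exists>q. qcontent q = 1 \<and> q * a0 = fst p * q \<and> q * b0 = snd p * q" if p: "p \<in> F" for p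
  proof -
    obtain a b where ab: "p = (a, b)"
      by (cases p)
    have *: "qre a = 0" "qre b = 0" "qnorm a = A" "qinner a b = C" "qnorm b = B"
      using p by (simp_all add: F_def ab)
    obtain q where "qcontent q = 1" "q * a0 = a * q" "q * b0 = b * q"
      using exists_intertwiner[OF *(1,2) pure0 *(3) gram0(1) *(4) gram0(2) *(5) gram0(3) A assms(2)]
      by blast
    then show ?thesis
      unfolding ab by auto
  qed
  then obtain q where q: "qcontent (q p) = 1" "q p * a0 = fst p * q p" "q p * b0 = snd p * q p"
    if "p \<in> F" for p
    by metis
  have norm0: "qnorm (q p) > 0" if "p \<in> F" for p
    using q(1)[OF that] by (auto simp: qcontent_def)
  have inj: "inj_on q F"
  proof (rule inj_onI)
    fix p p' assume p: "p \<in> F" "p' \<in> F" "q p = q p'"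
    have cancel: "x = y" if "x * q p = y * q p" for x y
    proof -
      have "x * (q p * qcnj (q p)) = y * (q p * qcnj (q p))"
        using that by (simp add: mult.assoc[symmetric])
      then show "x = y"
        using norm0[OF p(1)] by (simp add: mult_qcnj quat_of_int_commute quat_scale_cancel)
    qed
    have "fst p = fst p'" "snd p = snd p'"
      using q(2,3)[OF p(1)] q(2,3)[OF p(2)] p(3) by (auto intro: cancel)
    then show "p = p'"
      by (simp add: prod_eq_iff)
  qed
  define Q where "Q N = {q. qcontent q = 1 \<and> qnorm q = N \<and> (\<exists>a. q * a0 = a * q)}" for N
  have D0: "D > 0"
    using assms(2) by (simp add: D_def)
  have sub: "qnorm ` q ` F \<subseteq> pos_divisors (8 * D)"
  proof safe
    fix a b assume p: "(a, b) \<in> F"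
    have "qnorm (q (a, b)) dvd 8 * D"
      using intertwiner_norm_dvd[OF q[OF p] pure0] by (simp add: gram0 D_def)
    then show "qnorm (q (a, b)) \<in> pos_divisors (8 * D)"
      using norm0[OF p] by (simp add: pos_divisors_def)
  qed
  have fib: "finite {p \<in> q ` F. qnorm p = N} \<and> card {p \<in> q ` F. qnorm p = N} \<le> T * S * 6561"
    if N: "N \<in> pos_divisors (8 * D)" for N
  proof -
    have N0: "N > 0" "N \<le> 8 * D"
      using N D0 by (auto simp: pos_divisors_def intro: zdvd_imp_le)
    have "{p \<in> q ` F. qnorm p = N} \<subseteq> Q N"
      using q by (auto simp: Q_def)
    moreover have "finite (Q N)" "card (Q N) \<le> card (pos_divisors N) * S * 6561"
      unfolding Q_def
      using card_primitive_intertwiners[OF cont0 pure0(1) N0(1), unfolded gram0, OF S] by blast+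
    moreover have "card (pos_divisors N) * S * 6561 \<le> T * S * 6561"
      using T[OF N0[unfolded D_def]] by simp
    ultimately show ?thesis
      by (meson card_mono finite_subset order_trans)
  qed
  have "finite (pos_divisors (8 * D))"
    using D0 by (intro finite_pos_divisors) simp
  note bound = card_le_mult_fibers[OF this sub fib]
  have "card (pos_divisors (8 * D)) \<le> T"
    using D0 by (intro T) (simp_all add: D_def)
  then have "card (q ` F) \<le> T * (T * S * 6561)"
    using bound(2) by (meson mult_le_mono1 order_trans)
  then show ?thesis
    using bound(1) inj by (simp add: card_image finite_image_iff)
next
  case True
  show ?thesis
    unfolding True by simp
qed

text \<open>Multiplying c = conj u v by u shows that h = k / gcd (k, content c) divides u c', where
  c' is the primitive part of c. As for equal roots, inserting 2 = c' y + conj (c' y) makes 2 p conj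
  u divisible by h for any two factors p and u; the quotient, of norm 4 gcd^2, determines p.\<close>

lemma card_left_factors:
  fixes k :: int
  assumes c: "c \<noteq> 0" and k: "k > 0"
  defines "U \<equiv> {u. qnorm u = k \<and> (\<exists>v. c = qcnj u * v)}"
  shows "finite U \<and> card U \<le> card {t. qnorm t = 4 * (gcd k (qcontent c))\<^sup>2}"
proof (cases "U = {}")
  case False
  then obtain u where u: "u \<in> U" by blast
  define m where "m = qcontent c"
  obtain c' where c': "c = of_int m * c'" "qcontent c' = 1"
    using primitive_part[OF c] unfolding m_def by blast
  define g where "g = gcd k m"
  define h where "h = k div g"
  have g: "g > 0" "k = g * h"
    using k by (auto simp: g_def h_def)
  have h: "h > 0"
    using g k by (simp add: zero_less_mult_iff)
  have cop: "coprime h (m div g)"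
    unfolding h_def g_def using k by (simp add: div_gcd_coprime)
  obtain y where y: "qre (c' * y) = 1"
    using content_bezout[of c'] c' by auto
  have two: "c' * y + qcnj y * qcnj c' = 2"
    using add_qcnj[of "c' * y"] y by (simp add: qcnj_mult)
  have dvd: "qdvd h (p * c')" if p: "p \<in> U" for p
  proof -
    obtain v where v: "c = qcnj p * v" "qnorm p = k"
      using p by (auto simp: U_def)
    have "of_int m * (p * c') = p * c"
      by (simp add: c' quat_of_int_left_commute)
    also have "\<dots> = of_int k * v"
      unfolding v(1) by (simp add: mult.assoc[symmetric] mult_qcnj v(2))
    finally have eq: "m * x (p * c') = k * x v" if "x \<in> {qre, qi, qj, qk}" for x
      using that by (auto simp: quat_eq_iff)
    have "h dvd x (p * c')" if "x \<in> {qre, qi, qj, qk}" for x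
    proof -
      have "g * (m div g) = m"
        by (simp add: g_def)
      then have "g * (m div g * x (p * c')) = g * (h * x v)"
        using eq[OF that] g(2) by (metis mult.assoc)
      then have "m div g * x (p * c') = h * x v"
        using g by simp
      then show ?thesis
        using cop by (metis coprime_dvd_mult_right_iff dvd_triv_left)
    qed
    then show ?thesis
      by (simp add: qdvd_iff)
  qed
  have ex: "\<exists>t. 2 * (p * qcnj u) = of_int h * t" if p: "p \<in> U" for p
  proof -
    have "2 * (p * qcnj u) = p * (c' * y + qcnj y * qcnj c') * qcnj u"
      unfolding two by (simp add: quat_eq_iff quat_sel_times)
    also have "\<dots> = (p * c') * (y * qcnj u) + (p * qcnj y) * qcnj (u * c')"
      by (simp add: distrib_left distrib_right qcnj_mult mult.assoc)
    finally have eq: "2 * (p * qcnj u) = \<dots>" .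
    have "qdvd h (2 * (p * qcnj u))"
      unfolding eq using dvd[OF p] dvd[OF u]
      by (blast intro: qdvd_add qdvd_mult_left qdvd_mult_right qdvd_qcnj)
    then show ?thesis
      by (simp add: qdvd_def)
  qed
  then obtain t where t: "2 * (p * qcnj u) = of_int h * t p" if "p \<in> U" for p
    by metis
  have "inj_on t U"
  proof (rule inj_onI)
    fix p p' assume p: "p \<in> U" "p' \<in> U" "t p = t p'"
    then have "of_int 2 * (p * qcnj u) = of_int 2 * (p' * qcnj u)"
      using t by (metis of_int_numeral)
    then have "p * qcnj u * u = p' * qcnj u * u"
      by (simp only: quat_scale_cancel[of 2])
    then have "of_int k * p = of_int k * p'"
      using u by (simp add: mult.assoc qcnj_times U_def quat_of_int_commute)
    then show "p = p'"
      using k by (subst (asm) quat_scale_cancel) auto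
  qed
  moreover have "t ` U \<subseteq> {t. qnorm t = 4 * g\<^sup>2}"
  proof safe
    fix p assume p: "p \<in> U"
    have "qnorm (of_int 2 * (p * qcnj u)) = qnorm (of_int h * t p)"
      using t[OF p] by simp
    then have "4 * (k * k) = h * h * qnorm (t p)"
      using p u unfolding qnorm_mult qnorm_of_int by (simp add: U_def power2_eq_square)
    then have "h * h * (4 * g\<^sup>2) = h * h * qnorm (t p)"
      unfolding g(2) by (simp add: power2_eq_square algebra_simps)
    then show "qnorm (t p) = 4 * g\<^sup>2"
      using h by simp
  qed
  ultimately show ?thesis
    using card_inj_on_le[of t U] inj_on_finite[of t U] finite_qnorm[of "4 * g\<^sup>2"]
    unfolding g_def m_def by blast
next
  case True
  show ?thesis
    unfolding True by simp
qed

section \<open>Sums of two and of four squares\<close>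

lemma card_sum_two_squares:
  fixes T :: nat and n :: int
  assumes n: "n > 0"
    and T: "\<And>k. 0 < k \<Longrightarrow> k \<le> n \<Longrightarrow> card (pos_divisors k) \<le> T"
  defines "X \<equiv> {q. qnorm q = n \<and> qj q = 0 \<and> qk q = 0}"
  shows "finite X" "card X \<le> T * (T * 4 * 6561)"
proof -
  \<comment> \<open>The quaternions without j and k parts are those commuting with i. After removal
    of the content they are primitive intertwiners of i with itself, and 4 is the largest square
    root available in 16 |i|^2 = 16.\<close>
  define i where "i = Quat 0 1 0 0"
  have i: "qcontent i = 1" "qre i = 0" "qnorm i = 1"
    by (simp_all add: i_def qcontent_def qnorm_def)
  have S: "g \<le> int 4" if "g > 0" "g\<^sup>2 dvd 16 * qnorm i" for g :: int
  proof -
    have "g\<^sup>2 \<le> 4\<^sup>2"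
      using zdvd_imp_le[of "g\<^sup>2" 16] that i by simp
    then show ?thesis
      using power2_le_imp_le[of g 4] by simp
  qed
  define Q where "Q N = {q. qcontent q = 1 \<and> qnorm q = N \<and> (\<exists>a. q * i = a * q)}" for N
  have fib: "finite {q \<in> X. qcontent q = e} \<and> card {q \<in> X. qcontent q = e} \<le> T * 4 * 6561"
    if e: "e \<in> pos_divisors n" for e
  proof (cases "{q \<in> X. qcontent q = e} = {}")
    case False
    have prim: "\<exists>p \<in> Q (n div e\<^sup>2). q = of_int e * p" and n_e: "n = e\<^sup>2 * (n div e\<^sup>2)"
      if q: "q \<in> X" "qcontent q = e" for q
    proof -
      have "q \<noteq> 0"
        using e q qcontent_eq_0[of 0] by (auto simp: pos_divisors_def)
      then obtain p where p: "q = of_int e * p" "qcontent p = 1"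
        using primitive_part q(2) by blast
      have e0: "e \<noteq> 0"
        using e by (auto simp: pos_divisors_def)
      have n': "n = e\<^sup>2 * qnorm p"
        using q p by (auto simp: X_def qnorm_mult)
      then have "n div e\<^sup>2 = qnorm p"
        using e0 by simp
      moreover have "qj p = 0" "qk p = 0"
        using q p e0 by (auto simp: X_def)
      then have "p * i = i * p"
        by (simp add: i_def quat_eq_iff quat_sel_times)
      ultimately show "\<exists>p \<in> Q (n div e\<^sup>2). q = of_int e * p" "n = e\<^sup>2 * (n div e\<^sup>2)"
        using p n' unfolding Q_def by auto
    qed
    define N where "N = n div e\<^sup>2"
    have "n = e\<^sup>2 * N"
      using False n_e unfolding N_def by blast
    moreover have "e\<^sup>2 \<ge> 1"
      using e by (auto simp: pos_divisors_def one_le_power)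
    ultimately have N: "N > 0" "N \<le> n"
      using n mult_right_mono[of 1 "e\<^sup>2" N] by (auto simp: zero_less_mult_iff)
    have sub: "{q \<in> X. qcontent q = e} \<subseteq> (\<lambda>p. of_int e * p) ` Q N"
      using prim unfolding N_def by blast
    have Q: "finite (Q N)" "card (Q N) \<le> card (pos_divisors N) * 4 * 6561"
      unfolding Q_def
      using card_primitive_intertwiners[OF i(1,2) N(1) S] by blast+
    moreover have "card (pos_divisors N) * 4 * 6561 \<le> T * 4 * 6561"
      using T[OF N] by simp
    ultimately show ?thesis
      using sub surj_card_le[OF Q(1) sub] by (meson finite_imageI finite_subset order_trans)
  next
    case True
    show ?thesis
      unfolding True by simp
  qed
  have sub: "qcontent ` X \<subseteq> pos_divisors n"
  proof safe
    fix q assume q: "q \<in> X"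
    then have "q \<noteq> 0"
      using n by (auto simp: X_def)
    then have "qcontent q > 0"
      using qcontent_nonneg[of q] qcontent_eq_0[of q] by linarith
    moreover have "qcontent q dvd qnorm q"
      using qcontent_dvd[of q] unfolding qdvd_iff qnorm_def power2_eq_square by auto
    ultimately show "qcontent q \<in> pos_divisors n"
      using q by (simp add: pos_divisors_def X_def)
  qed
  have "finite (pos_divisors n)"
    using n by (intro finite_pos_divisors) simp
  note bound = card_le_mult_fibers[OF this sub fib]
  show "finite X"
    by (rule bound(1))
  show "card X \<le> T * (T * 4 * 6561)"
    using bound(2) T[OF n order_refl] by (meson mult_le_mono1 order_trans)
qed

lemma card_sum_four_squares:
  fixes T :: nat and n :: int
  assumes n: "n > 0"
    and T: "\<And>k. 0 < k \<Longrightarrow> k \<le> n \<Longrightarrow> card (pos_divisors k) \<le> T"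
  shows "card {q. qnorm q = n} \<le> nat (9 * n) * (T * (T * 4 * 6561))"
proof -
  define s where "s = \<lfloor>sqrt (real_of_int n)\<rfloor>"
  have s: "0 \<le> s" "s\<^sup>2 \<le> n" "n < (s + 1)\<^sup>2"
  proof -
    have s': "real_of_int s \<le> sqrt (real_of_int n)" "sqrt (real_of_int n) < real_of_int s + 1"
      unfolding s_def by linarith+
    show "0 \<le> s"
      using n unfolding s_def by simp
    then have "(real_of_int s)\<^sup>2 \<le> (sqrt (real_of_int n))\<^sup>2"
      using s' by (intro power_mono) auto
    then have "(real_of_int s)\<^sup>2 \<le> real_of_int n"
      using n by simp
    then show "s\<^sup>2 \<le> n"
      by (metis of_int_le_iff of_int_power)
    have "(sqrt (real_of_int n))\<^sup>2 < (real_of_int s + 1)\<^sup>2"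
      using s' n by (intro power_strict_mono) auto
    then have "real_of_int n < real_of_int ((s + 1)\<^sup>2)"
      using n by simp
    then show "n < (s + 1)\<^sup>2"
      by (simp only: of_int_less_iff)
  qed
  have s1: "s \<ge> 1"
    using s n by (cases "s = 0") auto
  \<comment> \<open>Fixing two coordinates costs O(n) choices and leaves a sum of two
    squares.\<close>
  define f where "f q = (qj q, qk q)" for q
  have T1: "T \<ge> 1"
  proof -
    have "1 \<in> pos_divisors n"
      by (simp add: pos_divisors_def)
    then have "card (pos_divisors n) \<noteq> 0"
      using n finite_pos_divisors[of n] by auto
    then show ?thesis
      using T[OF n order_refl] by linarith
  qed
  have sub: "f ` {q. qnorm q = n} \<subseteq> {-s..s} \<times> {-s..s}"
  proof -
    have "\<bar>x\<bar> \<le> s" if "x\<^sup>2 \<le> n" for x :: int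
    proof (rule ccontr)
      assume "\<not> \<bar>x\<bar> \<le> s"
      then have "(s + 1)\<^sup>2 \<le> \<bar>x\<bar>\<^sup>2"
        using s by (intro power_mono) auto
      then show False
        using that s by simp
    qed
    moreover have "(qj q)\<^sup>2 \<le> qnorm q" "(qk q)\<^sup>2 \<le> qnorm q" for q
      by (simp_all add: qnorm_def)
    ultimately show ?thesis
      unfolding f_def by (force simp: abs_le_iff)
  qed
  have fib: "finite {q \<in> {q. qnorm q = n}. f q = b} \<and>
      card {q \<in> {q. qnorm q = n}. f q = b} \<le> T * (T * 4 * 6561)" for b
  proof
    show fin: "finite {q \<in> {q. qnorm q = n}. f q = b}"
      using finite_qnorm[of n] by (rule rev_finite_subset) auto
    obtain c d where b: "b = (c, d)"
      by (cases b)
    define k where "k = n - c\<^sup>2 - d\<^sup>2"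
    define X where "X = {q. qnorm q = k \<and> qj q = 0 \<and> qk q = 0}"
    have inj: "inj_on (\<lambda>q. Quat (qre q) (qi q) 0 0) {q \<in> {q. qnorm q = n}. f q = b}"
      by (rule inj_onI) (auto simp: f_def b quat_eq_iff)
    have sub': "(\<lambda>q. Quat (qre q) (qi q) 0 0) ` {q \<in> {q. qnorm q = n}. f q = b} \<subseteq> X"
      by (auto simp: f_def b X_def k_def qnorm_def)
    have "finite X"
      unfolding X_def using finite_qnorm[of k] by (rule rev_finite_subset) auto
    from card_inj_on_le[OF inj sub' this]
    have le: "card {q \<in> {q. qnorm q = n}. f q = b} \<le> card X" .
    also have "card X \<le> T * (T * 4 * 6561)"
    proof -
      \<comment> \<open>The bound for two squares applies to positive k only; at k = 0 the single
        quaternion 0 remains, which T >= 1 absorbs.\<close>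
      consider "k < 0" | "k = 0" | "k > 0" by linarith
      then show ?thesis
      proof cases
        case 1
        then have "X = {}"
          unfolding X_def using qnorm_nonneg linorder_not_less by blast
        then show ?thesis by simp
      next
        case 2
        then have "X \<subseteq> {0}"
          unfolding X_def by auto
        then have "card X \<le> 1"
          by (metis card.empty card_insert_disjoint card_mono empty_iff finite.emptyI finite_insert One_nat_def)
        moreover have "1 \<le> T * (T * 4 * 6561)"
          using T1 by simp
        ultimately show ?thesis by linarith
      next
        case 3
        have "k \<le> n"
          unfolding k_def using zero_le_power2[of c] zero_le_power2[of d] by linarith
        then show ?thesis
          unfolding X_def using T by (intro card_sum_two_squares(2) 3) auto
      qed
    qed
    finally show "card {q \<in> {q. qnorm q = n}. f q = b} \<le> T * (T * 4 * 6561)" .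
  qed
  have "card ({-s..s} \<times> {-s..s}) = nat ((2 * s + 1) * (2 * s + 1))"
    using s by (simp add: card_cartesian_product nat_mult_distrib)
  also have "(2 * s + 1) * (2 * s + 1) \<le> (3 * s) * (3 * s)"
    using s1 by (intro mult_mono) auto
  also have "\<dots> \<le> 9 * n"
    using s by (simp add: power2_eq_square)
  finally have "card ({-s..s} \<times> {-s..s}) \<le> nat (9 * n)"
    by (simp add: nat_mono)
  moreover have "card {q. qnorm q = n} \<le> card ({-s..s} \<times> {-s..s}) * (T * (T * 4 * 6561))"
    by (rule card_le_mult_fibers(2)[OF _ sub fib]) simp
  ultimately show ?thesis
    by (meson mult_le_mono1 order_trans)
qed

section \<open>Close pairs with prescribed Gram matrix\<close>

definition qim :: "quat \<Rightarrow> quat" where "qim q = q - of_int (qre q)"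

text \<open>Total through \<open>div\<close>, but a true quotient only if n divides every
  coefficient.\<close>

definition qdiv :: "quat \<Rightarrow> int \<Rightarrow> quat" where
  "qdiv q n = Quat (qre q div n) (qi q div n) (qj q div n) (qk q div n)"

lemma qdvd_mult_div: "qdvd n q \<Longrightarrow> of_int n * qdiv q n = q"
  by (simp add: qdvd_iff qdiv_def quat_eq_iff)

lemma qre_qim [simp]: "qre (qim q) = 0"
  by (simp add: qim_def)

lemma qnorm_qim: "qnorm (qim q) = qnorm q - (qre q)\<^sup>2"
  by (simp add: qim_def quat_components)

lemma qinner_qim: "qinner (qim p) (qim q) = qinner p q - qre p * qre q"
  by (simp add: qim_def quat_components)

lemma qinner_scale: "qinner (of_int n * p) q = n * qinner p q" "qinner p (of_int n * q) = n * qinner p q"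
  by (simp_all add: qinner_def algebra_simps)

text \<open>The linear conditions place x + u and x + v on the sphere of x. As \<open>qnorm\<close>
  is a squared length, comparing its cube with L expresses length < L^(1/6) within the integers.
  Coinciding points are excluded here and counted apart.\<close>

definition close_pairs :: "int \<Rightarrow> (quat \<times> quat \<times> quat) set" where
  "close_pairs L = {(x, u, v). qnorm x = L \<and> 2 * qinner x u = - qnorm u \<and>
     2 * qinner x v = - qnorm v \<and> u \<noteq> 0 \<and> v \<noteq> 0 \<and> u \<noteq> v \<and>
     qnorm u ^ 3 < L \<and> qnorm v ^ 3 < L}"

text \<open>The determinant is the norm of the pure part of conj u v. If it vanished, u and v would
  be parallel; but a line through x meets the sphere in at most one further point, so u = v.\<close>

lemma close_pairs_gram_pos:
  assumes "(x, u, v) \<in> close_pairs L"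
  shows "qnorm u * qnorm v - (qinner u v)\<^sup>2 > 0"
proof -
  define c where "c = qcnj u * v"
  have eq: "qnorm (qim c) = qnorm u * qnorm v - (qinner u v)\<^sup>2"
    by (simp add: qnorm_qim c_def qnorm_mult qre_qcnj_mult)
  have "qim c \<noteq> 0"
  proof
    assume "qim c = 0"
    then have c: "c = of_int (qinner u v)"
      by (simp add: qim_def c_def qre_qcnj_mult)
    have "of_int (qnorm u) * v = u * c"
      by (simp add: c_def mult.assoc[symmetric] mult_qcnj)
    also have "\<dots> = of_int (qinner u v) * u"
      by (simp add: c quat_of_int_commute)
    finally have "2 * qinner x (of_int (qnorm u) * v) = 2 * qinner x (of_int (qinner u v) * u)"
      by simp
    then have "qnorm u * (2 * qinner x v) = qinner u v * (2 * qinner x u)"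
      by (simp add: qinner_scale)
    moreover have "2 * qinner x u = - qnorm u" "2 * qinner x v = - qnorm v"
      using assms by (simp_all add: close_pairs_def)
    ultimately have "qnorm u * (- qnorm v) = qinner u v * (- qnorm u)"
      by metis
    then have "qnorm u * qnorm v = qinner u v * qnorm u"
      by simp
    then have m: "qinner u v = qnorm v"
      using assms by (simp add: close_pairs_def)
    have "qnorm u * qnorm v = (qinner u v)\<^sup>2"
      using eq unfolding \<open>qim c = 0\<close> qnorm_eq_0[THEN iffD2, OF refl] by simp
    then have "qnorm u = qnorm v"
      using assms m by (simp add: close_pairs_def power2_eq_square)
    then have "qnorm (u - v) = 0"
      using m by (simp add: qnorm_diff)
    then show False
      using assms by (simp add: close_pairs_def)
  qed
  then show ?thesis
    using eq by (metis qnorm_pos)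
qed

definition close_pair_params :: "quat \<times> quat \<times> quat \<Rightarrow> int \<times> int \<times> int \<times> int" where
  "close_pair_params = (\<lambda>(x, u, v).
     (qnorm u, qnorm v, qinner u v, qcontent (qim (qcnj u * v))))"

lemma mult_lt_of_cubes_lt:
  fixes k l L :: int
  assumes "0 < k" "0 < l" "k ^ 3 < L" "l ^ 3 < L"
  shows "k * l < L" "k < L" "k * l * (k + l) < 2 * L"
proof -
  define M where "M = max k l"
  have M: "0 < M" "k \<le> M" "l \<le> M" "M ^ 3 < L"
    using assms by (auto simp: M_def max_def)
  have "k * l \<le> M * M"
    using M assms by (intro mult_mono) auto
  also have "M * M * 1 \<le> M * M * M"
    using M by (intro mult_left_mono) auto
  finally show "k * l < L"
    using M by (simp add: power3_eq_cube)
  have "k * 1 \<le> k * l"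
    using assms by (intro mult_left_mono) auto
  then show "k < L"
    using \<open>k * l < L\<close> by simp
  have "k * l * (k + l) \<le> M * M * (M + M)"
    using M assms by (intro mult_mono) auto
  then show "k * l * (k + l) < 2 * L"
    using M by (simp add: power3_eq_cube)
qed

text \<open>The part \<open>T * (T * S * 6561)\<close> counts the pairs (g, a); the rest counts the
  possible u, by way of quaternions of norm 4 gcd (k, m, e)^2. Given (g, a) and u, both v and x
  follow by cancelling conj u.\<close>

lemma card_close_pairs_fiber:
  fixes T S :: nat and k l m e L :: int
  assumes T: "\<And>n. 0 < n \<Longrightarrow> n \<le> 16 * L ^ 3 \<Longrightarrow> card (pos_divisors n) \<le> T"
    and S: "\<And>g. g > 0 \<Longrightarrow> g\<^sup>2 dvd 16 * ((k * l - m\<^sup>2) div e\<^sup>2) \<Longrightarrow> g \<le> int S"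
  defines "X \<equiv> {t \<in> close_pairs L. close_pair_params t = (k, l, m, e)}"
  shows "finite X \<and> card X \<le>
    T * (T * S * 6561) * (nat (9 * (4 * (gcd k (gcd m e))\<^sup>2)) * (T * (T * 4 * 6561)))"
proof (cases "X = {}")
  case False
  define f where "f t = (case t of (x, u, v) \<Rightarrow> (qdiv (qim (qcnj u * v)) e, qim (qcnj u * x)))"
    for t :: "quat \<times> quat \<times> quat"
  define \<delta> where "\<delta> = k * l - m\<^sup>2"
  \<comment> \<open>These are the inner products of x with u and v. The halving is exact, as k and l
    are even whenever the fibre is nonempty.\<close>
  define h h' where "h = - (k div 2)" and "h' = - (l div 2)"
  have X: "qnorm x = L" "qinner u x = h" "qinner v x = h'" "2 * h = - k" "2 * h' = - l"
    "qnorm u = k" "qnorm v = l" "qinner u v = m" "qcontent (qim (qcnj u * v)) = e"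
    "k > 0" "l > 0" "k ^ 3 < L" "l ^ 3 < L" "\<delta> > 0"
    if "(x, u, v) \<in> X" for x u v
  proof -
    have *: "2 * qinner x u = - k" "2 * qinner x v = - l"
      using that by (auto simp: X_def close_pairs_def close_pair_params_def)
    then show "qinner u x = h" "qinner v x = h'" "2 * h = - k" "2 * h' = - l"
      unfolding h_def h'_def qinner_commute[of _ x] by presburger+
    show "qnorm x = L" "qnorm u = k" "qnorm v = l" "qinner u v = m"
      "qcontent (qim (qcnj u * v)) = e" "k > 0" "l > 0" "k ^ 3 < L" "l ^ 3 < L"
      using that by (auto simp: X_def close_pairs_def close_pair_params_def)
    show "\<delta> > 0"
      using that close_pairs_gram_pos[of x u v L]
      by (auto simp: X_def close_pair_params_def \<delta>_def)
  qed
  have im_eq: "of_int e * qdiv (qim (qcnj u * v)) e = qim (qcnj u * v)"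
    if t: "(x, u, v) \<in> X" for x u v
    using X(9)[OF t] qcontent_dvd by (intro qdvd_mult_div) metis
  have c_eq: "qcnj u * v = of_int m + of_int e * qdiv (qim (qcnj u * v)) e"
    if t: "(x, u, v) \<in> X" for x u v
    using im_eq[OF t] X(8)[OF t] by (simp add: qim_def qre_qcnj_mult)
  obtain x0 u0 v0 where t0: "(x0, u0, v0) \<in> X"
    using False by auto
  note X0 = X[OF t0]
  have e: "e > 0"
  proof -
    have "qnorm (qim (qcnj u0 * v0)) = \<delta>"
      using X0 by (simp add: qnorm_qim qnorm_mult qre_qcnj_mult \<delta>_def)
    then have "qim (qcnj u0 * v0) \<noteq> 0"
      using X0 by auto
    then show ?thesis
      using X0 qcontent_nonneg[of "qim (qcnj u0 * v0)"] qcontent_eq_0[of "qim (qcnj u0 * v0)"]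
      by linarith
  qed
  have f: "qre g = 0 \<and> qre a = 0 \<and> qcontent g = 1 \<and> e\<^sup>2 * qnorm g = \<delta> \<and>
      e * qinner g a = k * h' - m * h \<and> qnorm a = k * L - h\<^sup>2"
    if t: "(x, u, v) \<in> X" and ga: "f (x, u, v) = (g, a)" for x u v g a
  proof -
    note Xt = X[OF t]
    have g': "g = qdiv (qim (qcnj u * v)) e" and a: "a = qim (qcnj u * x)"
      using ga by (simp_all add: f_def)
    have g: "of_int e * g = qim (qcnj u * v)"
      using im_eq[OF t] g' by simp
    have "e * qcontent g = e"
      using Xt(9) e qcontent_scale[of e g] unfolding g by simp
    then have "qcontent g = 1"
      using e by simp
    moreover have "e\<^sup>2 * qnorm g = \<delta>"
    proof -
      have "e\<^sup>2 * qnorm g = qnorm (of_int e * g)"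
        by (simp add: qnorm_mult)
      also have "\<dots> = \<delta>"
        unfolding g using Xt by (simp add: qnorm_qim qnorm_mult qre_qcnj_mult \<delta>_def)
      finally show ?thesis .
    qed
    moreover have "e * qinner g a = k * h' - m * h"
    proof -
      have "e * qinner g a = qinner (of_int e * g) a"
        by (simp add: qinner_scale)
      also have "\<dots> = k * h' - m * h"
        unfolding g a using Xt by (simp add: qinner_qim qinner_mult_left qre_qcnj_mult)
      finally show ?thesis .
    qed
    moreover have "qnorm a = k * L - h\<^sup>2"
      unfolding a using Xt by (simp add: qnorm_qim qnorm_mult qre_qcnj_mult)
    moreover have "qre g = 0" "qre a = 0"
      unfolding a g' by (simp_all add: qdiv_def)
    ultimately show ?thesis by blast
  qed
  obtain g0 a0 where ga0: "f (x0, u0, v0) = (g0, a0)"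
    by (cases "f (x0, u0, v0)")
  note f0 = f[OF t0 ga0]
  define A B C where "A = qnorm g0" and "B = qnorm a0" and "C = qinner g0 a0"
  define F where "F = {(a, b). qre a = 0 \<and> qre b = 0 \<and> qcontent a = 1 \<and>
    qnorm a = A \<and> qinner a b = C \<and> qnorm b = B}"
  have sub: "f ` X \<subseteq> F"
  proof
    fix p assume "p \<in> f ` X"
    then obtain x u v where t: "(x, u, v) \<in> X" "p = f (x, u, v)" by auto
    obtain g a where ga: "p = (g, a)"
      by (cases p)
    have *: "qre g = 0 \<and> qre a = 0 \<and> qcontent g = 1 \<and> e\<^sup>2 * qnorm g = \<delta> \<and>
      e * qinner g a = k * h' - m * h \<and> qnorm a = k * L - h\<^sup>2"
      using f[OF t(1)] t(2) ga by metis
    then have "e\<^sup>2 * qnorm g = e\<^sup>2 * A" "e * qinner g a = e * C" "qnorm a = B"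
      using f0 by (simp_all add: A_def B_def C_def)
    then have "qnorm g = A" "qinner g a = C" "qnorm a = B"
      using e by simp_all
    then show "p \<in> F"
      using * by (simp add: F_def ga)
  qed
  have A: "A = \<delta> div e\<^sup>2" "A > 0" "A \<le> \<delta>"
  proof -
    have *: "\<delta> = e\<^sup>2 * A"
      using f0 by (simp add: A_def)
    then show "A = \<delta> div e\<^sup>2" "A > 0"
      using e X0(14) by (auto simp: zero_less_mult_iff)
    have "1 * A \<le> e\<^sup>2 * A"
      using e \<open>A > 0\<close> by (intro mult_right_mono) (auto simp: one_le_power)
    then show "A \<le> \<delta>"
      using * by simp
  qed
  \<comment> \<open>With w = |u - v|^2, the number 4 L \<delta> - k l w is four times the Gram
    determinant of (x, u, v). As \<delta> is a positive integer, k l w < 4 L suffices, and w <= 2 (k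
    + l) reduces this to k l (k + l) < 2 L; here the smallness of u and v enters.\<close>
  have D: "A * B - C\<^sup>2 > 0"
  proof -
    define w where "w = k + l - 2 * m"
    have "4 * m\<^sup>2 \<le> 4 * (k * l)"
      using X0(14) by (simp add: \<delta>_def)
    also have "\<dots> \<le> (k + l)\<^sup>2"
      using zero_le_power2[of "k - l"] by (simp add: power2_eq_square algebra_simps)
    finally have "\<bar>2 * m\<bar> \<le> \<bar>k + l\<bar>"
      by (subst abs_le_square_iff) (simp add: power2_eq_square)
    then have "w \<le> 2 * (k + l)"
      using X0(10,11) abs_ge_minus_self[of "2 * m"] unfolding w_def by simp
    then have "k * l * w \<le> k * l * (2 * (k + l))"
      using X0 by (intro mult_left_mono) auto
    also have "\<dots> = 2 * (k * l * (k + l))"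
      by (simp add: algebra_simps)
    also have "\<dots> < 4 * L"
      using mult_lt_of_cubes_lt(3)[OF X0(10-13)] by linarith
    also have "4 * L * 1 \<le> 4 * L * \<delta>"
      using X0 zero_less_power[of k 3] by (intro mult_left_mono) auto
    finally have pos: "k * (4 * L * \<delta> - k * l * w) > 0"
      using X0 by simp
    have k: "k = - 2 * h" "l = - 2 * h'"
      using X0 by auto
    have "4 * (e\<^sup>2 * (A * B - C\<^sup>2)) = 4 * ((e\<^sup>2 * A) * B - (e * C)\<^sup>2)"
      by (simp add: power2_eq_square algebra_simps)
    also have "\<dots> = 4 * (\<delta> * (k * L - h\<^sup>2) - (k * h' - m * h)\<^sup>2)"
      using f0 by (simp add: A_def B_def C_def)
    also have "\<dots> = k * (4 * L * \<delta> - k * l * w)"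
      unfolding \<delta>_def w_def k by (simp add: power2_eq_square algebra_simps)
    finally have "0 < 4 * (e\<^sup>2 * (A * B - C\<^sup>2))"
      using pos by simp
    then show ?thesis
      using e by (simp add: zero_less_mult_iff)
  qed
  have L: "L > 0" "k * l < L" "k < L"
    using mult_lt_of_cubes_lt[of k l L] X0 zero_less_power[of k 3] by auto
  have "A * B - C\<^sup>2 \<le> A * B"
    by simp
  also have "\<dots> \<le> L * (L * L)"
  proof (rule mult_mono)
    show "A \<le> L"
      using A(3) L zero_le_power2[of m] unfolding \<delta>_def by linarith
    have "B \<le> k * L"
      using f0 by (simp add: B_def)
    also have "\<dots> \<le> L * L"
      using L by (intro mult_right_mono) auto
    finally show "B \<le> L * L" .
  qed (use L B_def in auto)
  also have "L * (L * L) = L ^ 3"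
    by (simp add: power3_eq_cube)
  finally have "A * B - C\<^sup>2 \<le> L ^ 3" .
  moreover have "8 * x \<le> 16 * y" if "x \<le> y" "0 < y" for x y :: int
    using that by linarith
  ultimately have DL: "8 * (A * B - C\<^sup>2) \<le> 16 * L ^ 3"
    using zero_less_power[OF L(1), of 3] by blast
  have F: "finite F \<and> card F \<le> T * (T * S * 6561)"
    unfolding F_def
  proof (rule card_pure_pairs[OF A(2) D])
    show "card (pos_divisors n) \<le> T" if "0 < n" "n \<le> 8 * (A * B - C\<^sup>2)" for n
      using that DL by (intro T) auto
    show "g \<le> int S" if "g > 0" "g\<^sup>2 dvd 16 * A" for g
      using S[of g] that unfolding A(1) \<delta>_def by blast
  qed
  define G where "G = gcd k (gcd m e)"
  have G: "G > 0" "G \<le> k"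
    using X0 unfolding G_def by (auto intro: zdvd_imp_le)
  have fib: "finite {t \<in> X. f t = p} \<and>
      card {t \<in> X. f t = p} \<le> nat (9 * (4 * G\<^sup>2)) * (T * (T * 4 * 6561))" if "p \<in> F" for p
  proof -
    obtain g a where p: "p = (g, a)"
      by (cases p)
    have g: "qcontent g = 1" "qre g = 0"
      using that by (simp_all add: F_def p)
    define c where "c = of_int m + of_int e * g"
    \<comment> \<open>The real part of c is m and its pure part is e times a primitive quaternion,
      so the two contribute separately to the content.\<close>
    have dvd_cont: "n dvd qcontent c \<longleftrightarrow> n dvd gcd m e" for n
    proof -
      have "n dvd qcontent c \<longleftrightarrow> n dvd m \<and> qdvd n (of_int e * g)"
        using g by (simp add: qdvd_iff_dvd_content[symmetric] qdvd_iff c_def)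
      also have "qdvd n (of_int e * g) \<longleftrightarrow> n dvd e"
        by (simp add: qdvd_iff_dvd_content qcontent_scale g)
      finally show ?thesis by simp
    qed
    have cont: "qcontent c = gcd m e"
      using zdvd_antisym_nonneg[OF qcontent_nonneg gcd_ge_0_int] dvd_cont dvd_refl by blast
    have c0: "c \<noteq> 0"
    proof -
      have "qcontent c \<noteq> 0"
        using cont e by simp
      then show ?thesis
        using qcontent_eq_0[of c] by blast
    qed
    define U where "U = {u. qnorm u = k \<and> (\<exists>v. c = qcnj u * v)}"
    have U: "finite U \<and> card U \<le> card {t. qnorm t = 4 * G\<^sup>2}"
      using card_left_factors[OF c0 X0(10)] unfolding U_def cont G_def .
    have uv: "qcnj u * v = c" "qcnj u * x = of_int h + a" "qnorm u = k"
      if t: "(x, u, v) \<in> {t \<in> X. f t = p}" for x u v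
    proof -
      have tX: "(x, u, v) \<in> X" "f (x, u, v) = (g, a)"
        using t by (auto simp: p)
      then show "qcnj u * v = c"
        using c_eq[OF tX(1)] by (simp add: f_def c_def)
      have "a = qim (qcnj u * x)"
        using tX(2) by (simp add: f_def)
      then show "qcnj u * x = of_int h + a"
        using X(2)[OF tX(1)] by (simp add: qim_def qre_qcnj_mult)
      show "qnorm u = k"
        using X(6)[OF tX(1)] .
    qed
    have cancel: "y = z" if "qcnj u * y = qcnj u * z" "qnorm u = k" for u y z
    proof -
      have "u * qcnj u * y = u * qcnj u * z"
        using that(1) by (simp add: mult.assoc)
      then show ?thesis
        using that(2) X0(10) by (simp add: mult_qcnj quat_scale_cancel)
    qed
    have inj: "inj_on (\<lambda>(x, u, v). u) {t \<in> X. f t = p}"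
    proof (rule inj_onI)
      fix t t' assume t: "t \<in> {t \<in> X. f t = p}" "t' \<in> {t \<in> X. f t = p}"
        and eq: "(case t of (x, u, v) \<Rightarrow> u) = (case t' of (x, u, v) \<Rightarrow> u)"
      obtain x u v where tt: "t = (x, u, v)"
        by (cases t)
      obtain x' v' where tt': "t' = (x', u, v')"
        using eq by (cases t') (auto simp: tt)
      note 1 = uv[OF t(1)[unfolded tt]] and 2 = uv[OF t(2)[unfolded tt']]
      have "v = v'" "x = x'"
        by (rule cancel[of u]; use 1 2 in simp)+
      then show "t = t'"
        by (simp add: tt tt')
    qed
    have im: "(\<lambda>(x, u, v). u) ` {t \<in> X. f t = p} \<subseteq> U"
    proof
      fix u assume "u \<in> (\<lambda>(x, u, v). u) ` {t \<in> X. f t = p}"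
      then obtain x v where "(x, u, v) \<in> {t \<in> X. f t = p}" by auto
      from uv[OF this] show "u \<in> U"
        unfolding U_def by blast
    qed
    have "4 * G\<^sup>2 \<le> 16 * L ^ 3"
    proof -
      have "4 * G\<^sup>2 \<le> 4 * (L * L)"
        unfolding power2_eq_square using G L by (intro mult_left_mono mult_mono) auto
      also have "L * L * 1 \<le> L * L * L"
        using L by (intro mult_left_mono) auto
      then have "4 * (L * L) \<le> 16 * L ^ 3"
        using L by (simp add: power3_eq_cube)
      finally show ?thesis .
    qed
    then have "card {t. qnorm t = 4 * G\<^sup>2} \<le> nat (9 * (4 * G\<^sup>2)) * (T * (T * 4 * 6561))"
      using G by (intro card_sum_four_squares T) auto
    moreover have "card {t \<in> X. f t = p} \<le> card U"
      using card_inj_on_le[OF inj im] U by blast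
    moreover have "finite {t \<in> X. f t = p}"
      using inj_on_finite[OF inj im] U by blast
    ultimately show ?thesis
      using U by linarith
  qed
  have "finite F"
    using F by blast
  note bound = card_le_mult_fibers[OF this sub fib]
  have "card X \<le> T * (T * S * 6561) * (nat (9 * (4 * G\<^sup>2)) * (T * (T * 4 * 6561)))"
    using bound(2) F by (meson mult_le_mono1 order_trans)
  then show ?thesis
    using bound(1) unfolding G_def by blast
next
  case True
  show ?thesis
    unfolding True by simp
qed

section \<open>Summation over Gram matrices\<close>

text \<open>At n = 0 the set is infinite and \<open>Max\<close> has no meaning; only positive n are
  of interest.\<close>

definition max_square_root :: "int \<Rightarrow> int" where
  "max_square_root n = Max {s. 0 < s \<and> s\<^sup>2 dvd n}"

lemma max_square_root:
  assumes "n > 0"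
  shows "max_square_root n > 0" "(max_square_root n)\<^sup>2 dvd n"
    and "\<And>s. 0 < s \<Longrightarrow> s\<^sup>2 dvd n \<Longrightarrow> s \<le> max_square_root n"
proof -
  let ?A = "{s. 0 < s \<and> s\<^sup>2 dvd n}"
  have sub: "?A \<subseteq> {0..n}"
  proof
    fix s assume s: "s \<in> ?A"
    then have "s * 1 \<le> s * s"
      by (intro mult_left_mono) auto
    also have "\<dots> \<le> n"
      using s assms by (auto simp: power2_eq_square intro: zdvd_imp_le)
    finally show "s \<in> {0..n}"
      using s by simp
  qed
  have fin: "finite ?A"
    using sub by (rule finite_subset) simp
  have "1 \<in> ?A"
    by simp
  then have "max_square_root n \<in> ?A"
    unfolding max_square_root_def using fin by (intro Max_in) blast+
  then show "max_square_root n > 0" "(max_square_root n)\<^sup>2 dvd n"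
    by auto
  show "s \<le> max_square_root n" if "0 < s" "s\<^sup>2 dvd n" for s
    unfolding max_square_root_def using that fin by (intro Max_ge) auto
qed

text \<open>The sequence \<open>harm n - ln n\<close> decreases, and its value at n = 1 is
  1.\<close>

lemma sum_inverse_le:
  fixes M :: int
  assumes "M \<ge> 1"
  shows "(\<Sum>i\<in>{1..M}. 1 / real_of_int i) \<le> 1 + ln (real_of_int M)"
proof -
  have "(\<Sum>i\<in>{1..M}. 1 / real_of_int i) = (\<Sum>i\<in>int ` {1..nat M}. 1 / real_of_int i)"
    using assms by (simp add: image_int_atLeastAtMost)
  also have "\<dots> = harm (nat M)"
    by (subst sum.reindex) (auto simp: harm_def field_simps)
  also have "\<dots> \<le> 1 + ln (real_of_int M)"
  proof -
    have "1 \<le> nat M"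
      using assms by simp
    from euler_mascheroni_sequence_decreasing[OF zero_less_one this] show ?thesis
      using assms by (simp add: harm_def)
  qed
  finally show ?thesis .
qed

text \<open>These conditions hold for the parameters of every close pair with norms at most M; e^2
  divides the determinant because the latter is the norm of e g.\<close>

definition gram_params :: "int \<Rightarrow> (int \<times> int \<times> int \<times> int) set" where
  "gram_params M = {(k, l, m, e). 1 \<le> k \<and> k \<le> M \<and> 1 \<le> l \<and> l \<le> M \<and> m\<^sup>2 < k * l \<and>
     1 \<le> e \<and> e\<^sup>2 dvd k * l - m\<^sup>2}"

lemma gram_params_bounds:
  assumes "(k, l, m, e) \<in> gram_params M"
  shows "k * l \<le> M\<^sup>2" "\<bar>m\<bar> \<le> M" "e \<le> M" "(k * l - m\<^sup>2) div e\<^sup>2 > 0"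
    "(k * l - m\<^sup>2) = e\<^sup>2 * ((k * l - m\<^sup>2) div e\<^sup>2)"
proof -
  have M: "M \<ge> 1"
    using assms by (auto simp: gram_params_def)
  show kl: "k * l \<le> M\<^sup>2"
    using assms unfolding power2_eq_square by (intro mult_mono) (auto simp: gram_params_def)
  have "m\<^sup>2 \<le> M\<^sup>2"
    using assms kl by (auto simp: gram_params_def)
  then show "\<bar>m\<bar> \<le> M"
    using M abs_le_square_iff[of m M] by simp
  show eq: "(k * l - m\<^sup>2) = e\<^sup>2 * ((k * l - m\<^sup>2) div e\<^sup>2)"
    using assms by (simp add: gram_params_def)
  have pos: "k * l - m\<^sup>2 > 0" "e\<^sup>2 > 0"
    using assms by (auto simp: gram_params_def)
  have "e\<^sup>2 \<le> k * l - m\<^sup>2"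
    using assms pos by (auto simp: gram_params_def intro: zdvd_imp_le)
  also have "\<dots> \<le> M\<^sup>2"
    using kl zero_le_power2[of m] by linarith
  finally show "e \<le> M"
    using M power2_le_imp_le[of e M] by simp
  show "(k * l - m\<^sup>2) div e\<^sup>2 > 0"
    using zero_less_mult_pos[OF _ pos(2)] pos(1) eq by metis
qed

lemma finite_gram_params: "finite (gram_params M)"
proof -
  have "gram_params M \<subseteq> {1..M} \<times> {1..M} \<times> {-M..M} \<times> {1..M}"
  proof safe
    fix k l m e assume p: "(k, l, m, e) \<in> gram_params M"
    show "k \<in> {1..M}" "l \<in> {1..M}" "m \<in> {-M..M}" "e \<in> {1..M}"
      using p gram_params_bounds(2,3)[OF p] by (auto simp: gram_params_def)
  qed
  then show ?thesis
    by (rule finite_subset) simp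
qed

lemma int_le_divI: "0 < h \<Longrightarrow> a * h \<le> b \<Longrightarrow> a \<le> b div (h :: int)"
  using zdiv_mono1[of "a * h" b h] by simp

lemma card_gram_params_fiber:
  fixes T :: nat and g e s M :: int
  assumes T: "\<And>n. 0 < n \<Longrightarrow> n \<le> 16 * M\<^sup>2 \<Longrightarrow> card (pos_divisors n) \<le> T"
    and g: "1 \<le> g" "g \<le> M" and e: "1 \<le> e" and s: "1 \<le> s"
  defines "Y \<equiv> {(k, l, m, d) \<in> gram_params M. gcd k (gcd m d) = g \<and> d = g * e \<and>
    max_square_root (16 * ((k * l - m\<^sup>2) div d\<^sup>2)) = s}"
  shows "real (card Y) \<le> 48 * real T * real_of_int M ^ 3 / real_of_int (g ^ 3 * e\<^sup>2 * s\<^sup>2)"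
proof -
  \<comment> \<open>Since t starts at 1, it takes at most R values with no extra 1 added; this
    matters when the denominator exceeds 16 M^2.\<close>
  define R where "R = 16 * M\<^sup>2 div (g\<^sup>2 * e\<^sup>2 * s\<^sup>2)"
  define B where "B = {-(M div g)..M div g} \<times> {1..R}"
  define f where "f p = (case p of (k, l, m, d) \<Rightarrow>
    (m div g, 16 * ((k * l - m\<^sup>2) div d\<^sup>2) div s\<^sup>2))" for p :: "int \<times> int \<times> int \<times> int"
  have Y: "m = g * m' \<and> d = g * e \<and> t > 0 \<and> 16 * (k * l) = 16 * (g * m')\<^sup>2 + g\<^sup>2 * e\<^sup>2 * s\<^sup>2 * t"
    if p: "(k, l, m, d) \<in> Y" "f (k, l, m, d) = (m', t)" for k l m d m' t
  proof -
    have gp: "(k, l, m, d) \<in> gram_params M" and d: "d = g * e" and gm: "gcd k (gcd m d) = g"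
      and ms: "max_square_root (16 * ((k * l - m\<^sup>2) div d\<^sup>2)) = s"
      using p(1) by (auto simp: Y_def)
    define q where "q = (k * l - m\<^sup>2) div d\<^sup>2"
    note b = gram_params_bounds(4,5)[OF gp, folded q_def]
    have "g dvd m"
      using gm by (metis dvd_trans gcd_dvd1 gcd_dvd2)
    then have m: "m = g * m'"
      using p(2) by (auto simp: f_def)
    have t: "t = 16 * q div s\<^sup>2"
      using p(2) by (simp add: f_def q_def)
    have "s\<^sup>2 dvd 16 * q"
      using max_square_root(2)[of "16 * q"] b(1) unfolding ms[folded q_def] by simp
    then have st: "16 * q = s\<^sup>2 * t"
      by (simp only: t dvd_mult_div_cancel)
    have "0 < s\<^sup>2 * t"
      unfolding st[symmetric] using b(1) by simp
    then have "t > 0"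
      by (rule zero_less_mult_pos) (use s in simp)
    have kl: "k * l = m\<^sup>2 + d\<^sup>2 * q"
      using b(2) by linarith
    have "16 * (k * l) = 16 * m\<^sup>2 + d\<^sup>2 * (16 * q)"
      unfolding kl by simp
    then have "16 * (k * l) = 16 * (g * m')\<^sup>2 + g\<^sup>2 * e\<^sup>2 * s\<^sup>2 * t"
      unfolding st unfolding d m by (simp add: power_mult_distrib)
    with \<open>t > 0\<close> m d show ?thesis
      by blast
  qed
  have sub: "f ` Y \<subseteq> B"
  proof
    fix b assume "b \<in> f ` Y"
    then obtain k l m d where p: "(k, l, m, d) \<in> Y" "b = f (k, l, m, d)"
      by (auto simp: Y_def)
    obtain m' t where b: "b = (m', t)"
      by (cases b)
    note Y' = Y[OF p(1) p(2)[unfolded b, symmetric]]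
    have gp: "(k, l, m, d) \<in> gram_params M"
      using p(1) by (auto simp: Y_def)
    note bounds = gram_params_bounds[OF gp]
    have "g * \<bar>m'\<bar> \<le> M"
      using bounds(2) Y' g by (simp add: abs_mult)
    then have "\<bar>m'\<bar> \<le> M div g"
      using g by (intro int_le_divI) (simp_all add: mult.commute)
    moreover have "t * (g\<^sup>2 * e\<^sup>2 * s\<^sup>2) \<le> 16 * M\<^sup>2"
    proof -
      have "g\<^sup>2 * e\<^sup>2 * s\<^sup>2 * t \<le> 16 * (k * l)"
        using Y' by simp
      then show ?thesis
        using bounds(1) by (simp add: mult.commute)
    qed
    then have "t \<le> R"
      unfolding R_def using g e s by (intro int_le_divI) simp_all
    ultimately show "b \<in> B"
      using Y' by (auto simp: b B_def abs_le_iff)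
  qed
  have fib: "finite {p \<in> Y. f p = b} \<and> card {p \<in> Y. f p = b} \<le> T" if "b \<in> B" for b
  proof -
    obtain m' t where b: "b = (m', t)"
      by (cases b)
    have t: "t \<ge> 1"
      using that by (simp add: B_def b)
    define n where "n = 16 * (g * m')\<^sup>2 + g\<^sup>2 * e\<^sup>2 * s\<^sup>2 * t"
    have pos: "g\<^sup>2 * e\<^sup>2 * s\<^sup>2 * t > 0"
      using g e s t by simp
    then have n: "n > 0"
      unfolding n_def using zero_le_power2[of "g * m'"] by linarith
    have Yn: "m = g * m'" "d = g * e" "16 * (k * l) = n" "k > 0" "k * l \<le> M\<^sup>2"
      if p: "(k, l, m, d) \<in> {p \<in> Y. f p = b}" for k l m d
    proof -
      have p': "(k, l, m, d) \<in> Y" "f (k, l, m, d) = (m', t)"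
        using p b by simp_all
      then have gp: "(k, l, m, d) \<in> gram_params M"
        by (auto simp: Y_def)
      from Y[OF p'] show "m = g * m'" "d = g * e" "16 * (k * l) = n"
        by (simp_all add: n_def)
      show "k * l \<le> M\<^sup>2"
        by (rule gram_params_bounds(1)[OF gp])
      show "k > 0"
        using gp by (simp add: gram_params_def)
    qed
    \<comment> \<open>Once b is fixed, so are n, m and d, and 16 k l = n lets the divisor k of n
      determine l.\<close>
    have inj: "inj_on fst {p \<in> Y. f p = b}"
    proof (rule inj_onI)
      fix p p' assume p: "p \<in> {p \<in> Y. f p = b}" "p' \<in> {p \<in> Y. f p = b}" "fst p = fst p'"
      obtain k l m d where 1: "p = (k, l, m, d)"
        by (cases p)
      obtain l' m'' d' where 2: "p' = (k, l', m'', d')"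
        using p(3) by (cases p') (simp add: 1)
      note 3 = Yn[OF p(1)[unfolded 1]] and 4 = Yn[OF p(2)[unfolded 2]]
      have "k * l = k * l'"
        using 3(3) 4(3) by linarith
      then show "p = p'"
        using 3 4 by (simp add: 1 2)
    qed
    have im: "fst ` {p \<in> Y. f p = b} \<subseteq> pos_divisors n"
    proof
      fix k assume "k \<in> fst ` {p \<in> Y. f p = b}"
      then obtain l m d where "(k, l, m, d) \<in> {p \<in> Y. f p = b}"
        by auto
      note 1 = Yn[OF this]
      have "k dvd n"
        unfolding 1(3)[symmetric] by simp
      then show "k \<in> pos_divisors n"
        using 1 by (simp add: pos_divisors_def)
    qed
    have fin: "finite (pos_divisors n)"
      using n by (intro finite_pos_divisors) simp
    have "card {p \<in> Y. f p = b} \<le> T"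
    proof (cases "{p \<in> Y. f p = b} = {}")
      case False
      then obtain k l m d where "(k, l, m, d) \<in> {p \<in> Y. f p = b}"
        by auto
      from Yn[OF this] have "n \<le> 16 * M\<^sup>2"
        by linarith
      then show ?thesis
        using card_inj_on_le[OF inj im fin] T[OF n] by linarith
    next
      case True
      show ?thesis
        unfolding True by simp
    qed
    then show ?thesis
      using inj_on_finite[OF inj im fin] by blast
  qed
  have "finite B"
    by (simp add: B_def)
  note bound = card_le_mult_fibers(2)[OF this sub fib]
  have Mg: "M div g \<ge> 1"
    using g by (intro int_le_divI) simp_all
  have R: "R \<ge> 0"
    unfolding R_def using g e s by (intro pos_imp_zdiv_nonneg_iff[THEN iffD2]) auto
  have "real (card B) = (2 * real_of_int (M div g) + 1) * real_of_int R"
    using Mg R by (simp add: B_def card_cartesian_product)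
  \<comment> \<open>The constant 48 is 3 * 16: as \<open>M div g\<close> is at least 1, there are at
    most 3 M / g values of m'.\<close>
  also have "\<dots> \<le> (3 * (real_of_int M / real_of_int g)) *
      (16 * (real_of_int M)\<^sup>2 / (real_of_int g ^ 2 * real_of_int e ^ 2 * real_of_int s ^ 2))"
  proof (rule mult_mono)
    have "2 * real_of_int (M div g) + 1 \<le> 3 * real_of_int (M div g)"
      using Mg by simp
    also have "real_of_int (M div g) \<le> real_of_int M / real_of_int g"
      by (rule real_of_int_div4)
    finally show "2 * real_of_int (M div g) + 1 \<le> 3 * (real_of_int M / real_of_int g)"
      by simp
    have "real_of_int R \<le> real_of_int (16 * M\<^sup>2) / real_of_int (g\<^sup>2 * e\<^sup>2 * s\<^sup>2)"
      unfolding R_def by (rule real_of_int_div4)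
    then show "real_of_int R \<le>
        16 * (real_of_int M)\<^sup>2 / (real_of_int g ^ 2 * real_of_int e ^ 2 * real_of_int s ^ 2)"
      by simp
  qed (use g R in auto)
  also have "\<dots> = 48 * real_of_int M ^ 3 / real_of_int (g ^ 3 * e\<^sup>2 * s\<^sup>2)"
    by (simp add: power2_eq_square power3_eq_cube)
  finally have "real (card B) * real T \<le> 48 * real_of_int M ^ 3 / real_of_int (g ^ 3 * e\<^sup>2 * s\<^sup>2) * real T"
    by (rule mult_right_mono) simp
  moreover have "real (card Y) \<le> real (card B) * real T"
    using bound by (metis of_nat_le_iff of_nat_mult)
  ultimately show ?thesis
    by (simp add: mult_ac)
qed

text \<open>The weight s g^2 times the fibre bound leaves 1 / (g e^2 s); e^2 is weakened to e so
  that three harmonic sums share one estimate. The 4 in the logarithm comes from s <= 4 M, as s^2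
  divides 16 times a positive number that is at most M^2.\<close>

lemma sum_gram_params_le:
  fixes T :: nat and M :: int
  assumes T: "\<And>n. 0 < n \<Longrightarrow> n \<le> 16 * M\<^sup>2 \<Longrightarrow> card (pos_divisors n) \<le> T" and M: "M \<ge> 1"
  shows "(\<Sum>(k, l, m, d)\<in>gram_params M.
      real_of_int (max_square_root (16 * ((k * l - m\<^sup>2) div d\<^sup>2)) * (gcd k (gcd m d))\<^sup>2))
    \<le> 48 * real T * real_of_int M ^ 3 * (1 + ln (4 * real_of_int M)) ^ 3"
proof -
  define \<psi> where "\<psi> p = (case p of (k, l, m, d) \<Rightarrow> (gcd k (gcd m d), d div gcd k (gcd m d),
    max_square_root (16 * ((k * l - m\<^sup>2) div d\<^sup>2))))" for p :: "int \<times> int \<times> int \<times> int"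
  define w where "w q = (case q of (g, e, s) \<Rightarrow> real_of_int (s * g\<^sup>2))"
    for q :: "int \<times> int \<times> int"
  let ?Q = "{1..M} \<times> {1..M} \<times> {1..4 * M}"
  let ?H = "1 + ln (4 * real_of_int M)"
  have params: "g \<ge> 1 \<and> g \<le> M \<and> d = g * (d div g) \<and> d div g \<ge> 1 \<and> d div g \<le> M \<and> s \<ge> 1 \<and> s \<le> 4 * M"
    if p: "(k, l, m, d) \<in> gram_params M" and g: "g = gcd k (gcd m d)"
      and s: "s = max_square_root (16 * ((k * l - m\<^sup>2) div d\<^sup>2))" for k l m d g s
  proof -
    note b = gram_params_bounds[OF p]
    have d: "d \<ge> 1" "k \<ge> 1" "k \<le> M"
      using p by (auto simp: gram_params_def)
    have "g dvd k" "g dvd d"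
      unfolding g by (meson dvd_trans gcd_dvd1 gcd_dvd2)+
    have g1: "g > 0"
      using d unfolding g by simp
    have "g \<le> k"
      using \<open>g dvd k\<close> d by (intro zdvd_imp_le) auto
    have dg: "d = g * (d div g)"
      using \<open>g dvd d\<close> by simp
    have "0 < g * (d div g)"
      using d dg by linarith
    then have e1: "d div g > 0"
      using g1 by (rule zero_less_mult_pos)
    have "1 * (d div g) \<le> g * (d div g)"
      using g1 e1 by (intro mult_right_mono) auto
    then have "d div g \<le> d"
      using dg by simp
    define q where "q = (k * l - m\<^sup>2) div d\<^sup>2"
    have q: "q > 0" "k * l - m\<^sup>2 = d\<^sup>2 * q"
      using b(4,5) by (simp_all add: q_def)
    have "1 * q \<le> d\<^sup>2 * q"
      using d q by (intro mult_right_mono) (auto simp: one_le_power)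
    also have "\<dots> \<le> M\<^sup>2"
      using q(2) b(1) zero_le_power2[of m] by linarith
    finally have qM: "q \<le> M\<^sup>2" by simp
    have s1: "s > 0" "s\<^sup>2 dvd 16 * q"
      unfolding s q_def[symmetric] using q by (auto intro: max_square_root)
    have "s\<^sup>2 \<le> 16 * q"
      using s1 q by (intro zdvd_imp_le) auto
    then have "s\<^sup>2 \<le> (4 * M)\<^sup>2"
      using qM by (simp add: power_mult_distrib)
    then have "s \<le> 4 * M"
      using M power2_le_imp_le[of s "4 * M"] by simp
    with g1 \<open>g \<le> k\<close> d dg e1 \<open>d div g \<le> d\<close> b(3) s1 show ?thesis by linarith
  qed
  have im: "\<psi> ` gram_params M \<subseteq> ?Q"
  proof
    fix q assume "q \<in> \<psi> ` gram_params M"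
    then obtain k l m d where p: "(k, l, m, d) \<in> gram_params M" "q = \<psi> (k, l, m, d)"
      by auto
    show "q \<in> ?Q"
      using params[OF p(1) refl refl] by (simp add: p(2) \<psi>_def)
  qed
  have fib: "(\<Sum>p\<in>{p \<in> gram_params M. \<psi> p = q}. w (\<psi> p))
      \<le> (case q of (g, e, s) \<Rightarrow> 48 * real T * real_of_int M ^ 3 * (1 / real_of_int g * (1 / real_of_int e * (1 / real_of_int s))))" if q: "q \<in> ?Q" for q
  proof -
    obtain g e s where ges: "q = (g, e, s)"
      by (cases q)
    have 1: "1 \<le> g" "g \<le> M" "1 \<le> e" "1 \<le> s"
      using q by (auto simp: ges)
    define Y where "Y = {(k, l, m, d) \<in> gram_params M. gcd k (gcd m d) = g \<and> d = g * e \<and>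
      max_square_root (16 * ((k * l - m\<^sup>2) div d\<^sup>2)) = s}"
    have "{p \<in> gram_params M. \<psi> p = q} \<subseteq> Y"
    proof
      fix p assume p: "p \<in> {p \<in> gram_params M. \<psi> p = q}"
      obtain k l m d where p': "p = (k, l, m, d)"
        by (cases p)
      have gp: "(k, l, m, d) \<in> gram_params M" and ps: "\<psi> (k, l, m, d) = (g, e, s)"
        using p by (simp_all add: p' ges)
      have "gcd k (gcd m d) = g" "d div gcd k (gcd m d) = e"
        "max_square_root (16 * ((k * l - m\<^sup>2) div d\<^sup>2)) = s"
        using ps unfolding \<psi>_def prod.case prod.inject by blast+
      moreover have "d = gcd k (gcd m d) * (d div gcd k (gcd m d))"
        using params[OF gp refl refl] by blast
      ultimately have "d = g * e"
        by metis
      with \<open>gcd k (gcd m d) = g\<close> \<open>max_square_root (16 * ((k * l - m\<^sup>2) div d\<^sup>2)) = s\<close> gp show "p \<in> Y"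
        unfolding Y_def p' by blast
    qed
    moreover have "finite Y"
      unfolding Y_def using finite_gram_params[of M] by (rule rev_finite_subset) auto
    ultimately have "card {p \<in> gram_params M. \<psi> p = q} \<le> card Y"
      by (rule card_mono[rotated])
    moreover have Y: "real (card Y) \<le> 48 * real T * real_of_int M ^ 3 / real_of_int (g ^ 3 * e\<^sup>2 * s\<^sup>2)"
      unfolding Y_def using T 1 by (rule card_gram_params_fiber)
    ultimately have le: "real (card {p \<in> gram_params M. \<psi> p = q}) \<le>
        48 * real T * real_of_int M ^ 3 / real_of_int (g ^ 3 * e\<^sup>2 * s\<^sup>2)"
      by linarith
    have "(\<Sum>p\<in>{p \<in> gram_params M. \<psi> p = q}. w (\<psi> p))
        = real (card {p \<in> gram_params M. \<psi> p = q}) * (real_of_int s * (real_of_int g)\<^sup>2)"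
      by (simp add: ges w_def)
    also have "\<dots> \<le> 48 * real T * real_of_int M ^ 3 / real_of_int (g ^ 3 * e\<^sup>2 * s\<^sup>2) * (real_of_int s * (real_of_int g)\<^sup>2)"
      using le 1 by (intro mult_right_mono) auto
    also have "\<dots> = 48 * real T * real_of_int M ^ 3 * (1 / real_of_int g * (1 / (real_of_int e * real_of_int e) * (1 / real_of_int s)))"
      using 1 by (simp add: power2_eq_square power3_eq_cube field_simps)
    also have "\<dots> \<le> 48 * real T * real_of_int M ^ 3 * (1 / real_of_int g * (1 / real_of_int e * (1 / real_of_int s)))"
    proof -
      have "1 / (real_of_int e * real_of_int e) \<le> 1 / real_of_int e"
        using 1 by (simp add: field_simps)
      then show ?thesis
        using 1 M by (intro mult_left_mono mult_right_mono) auto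
    qed
    finally show ?thesis
      by (simp add: ges)
  qed
  have "(\<Sum>(k, l, m, d)\<in>gram_params M.
      real_of_int (max_square_root (16 * ((k * l - m\<^sup>2) div d\<^sup>2)) * (gcd k (gcd m d))\<^sup>2))
    = (\<Sum>p\<in>gram_params M. w (\<psi> p))"
    by (intro sum.cong) (auto simp: w_def \<psi>_def)
  also have "\<dots> = (\<Sum>q\<in>?Q. \<Sum>p\<in>{p \<in> gram_params M. \<psi> p = q}. w (\<psi> p))"
    by (rule sum.group[OF finite_gram_params _ im, symmetric]) simp
  also have "\<dots> \<le> (\<Sum>q\<in>?Q. case q of (g, e, s) \<Rightarrow> 48 * real T * real_of_int M ^ 3 * (1 / real_of_int g * (1 / real_of_int e * (1 / real_of_int s))))"
    by (rule sum_mono) (rule fib)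
  also have "\<dots> = 48 * real T * real_of_int M ^ 3 * ((\<Sum>g\<in>{1..M}. 1 / real_of_int g) *
      ((\<Sum>e\<in>{1..M}. 1 / real_of_int e) * (\<Sum>s\<in>{1..4 * M}. 1 / real_of_int s)))"
    by (simp only: sum.cartesian_product' prod.case sum_distrib_left[symmetric]
        sum_distrib_right[symmetric])
  also have "\<dots> \<le> 48 * real T * real_of_int M ^ 3 * (?H * (?H * ?H))"
  proof -
    have "ln (real_of_int M) \<le> ln (4 * real_of_int M)"
      using M by simp
    then have 1: "(\<Sum>g\<in>{1..M}. 1 / real_of_int g) \<le> ?H"
      using sum_inverse_le[OF M] by linarith
    have 2: "(\<Sum>s\<in>{1..4 * M}. 1 / real_of_int s) \<le> ?H"
      using sum_inverse_le[of "4 * M"] M by simp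
    have 0: "0 \<le> (\<Sum>g\<in>{1..N}. 1 / real_of_int g)" for N :: int
      by (rule sum_nonneg) simp
    have "0 \<le> ?H"
      using M by (intro add_nonneg_nonneg) auto
    then show ?thesis
      using 0 1 2 M by (intro mult_left_mono mult_mono mult_nonneg_nonneg) auto
  qed
  also have "\<dots> = 48 * real T * real_of_int M ^ 3 * ?H ^ 3"
    by (simp add: power3_eq_cube)
  finally show ?thesis .
qed

section \<open>The divisor bound\<close>

text \<open>Every divisor of a product is a product of divisors. Surjectivity alone gives the
  inequality, so common factors of a and b do no harm.\<close>

lemma card_divisors_mult_le:
  fixes a b :: nat
  assumes "a > 0" "b > 0"
  shows "card {d. d dvd a * b} \<le> card {d. d dvd a} * card {d. d dvd b}"
proof -
  have "{d. d dvd a * b} \<subseteq> (\<lambda>(x, y). x * y) ` ({d. d dvd a} \<times> {d. d dvd b})"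
    by (auto dest!: division_decomp)
  then have "card {d. d dvd a * b} \<le> card ({d. d dvd a} \<times> {d. d dvd b})"
    using assms by (intro surj_card_le) auto
  then show ?thesis
    by (simp add: card_cartesian_product)
qed

lemma card_divisors_prime_power_le: "prime (p :: nat) \<Longrightarrow> card {d. d dvd p ^ a} \<le> a + 1"
proof -
  assume "prime p"
  then have "{d. d dvd p ^ a} \<subseteq> (\<lambda>i. p ^ i) ` {..a}"
    by (auto simp: divides_primepow_nat)
  from surj_card_le[OF _ this] show ?thesis by simp
qed

text \<open>Prime powers p^a are split off one at a time. If p^\<epsilon> >= 2, then a + 1 <= 2^a <=
  p^(a \<epsilon>) costs nothing. The smaller primes cost a factor c each, and there are at most P
  of them.\<close>

lemma divisor_bound_nat:
  fixes \<epsilon> :: real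
  assumes "\<epsilon> > 0"
  obtains C where "C \<ge> 1" "\<And>n :: nat. n > 0 \<Longrightarrow> real (card {d. d dvd n}) \<le> C * real n powr \<epsilon>"
proof -
  define P where "P = nat \<lceil>2 powr (1 / \<epsilon>)\<rceil>"
  \<comment> \<open>Chosen so that a + 1 <= c (1 + \<epsilon> a ln 2), where the bracket is at most
    2^(a \<epsilon>).\<close>
  define c where "c = 1 + 1 / (\<epsilon> * ln 2)"
  define w where "w n = card {p. prime p \<and> p dvd n \<and> p < P}" for n
  have c1: "c \<ge> 1"
    using assms by (simp add: c_def)
  have large: "real a + 1 \<le> (real p ^ a) powr \<epsilon>" if "p \<ge> P" for p a
  proof -
    have "2 powr (1 / \<epsilon>) \<le> real P"
      unfolding P_def by linarith
    also have "\<dots> \<le> real p"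
      using that by simp
    finally have p: "2 powr (1 / \<epsilon>) \<le> real p" .
    then have p0: "real p > 0"
      using powr_gt_zero[of 2 "1 / \<epsilon>"] by linarith
    have "2 = (2 powr (1 / \<epsilon>)) powr \<epsilon>"
      using assms by (simp add: powr_powr)
    also have "\<dots> \<le> real p powr \<epsilon>"
      using p assms by (intro powr_mono2) auto
    finally have "2 ^ a \<le> (real p powr \<epsilon>) ^ a"
      by (intro power_mono) auto
    also have "\<dots> = (real p ^ a) powr \<epsilon>"
      using p0 by (simp add: powr_realpow[symmetric] powr_powr mult.commute)
    finally have "2 ^ a \<le> (real p ^ a) powr \<epsilon>" .
    moreover have "real a + 1 \<le> 2 ^ a"
    proof -
      have "a + 1 \<le> 2 ^ a"
        by (induction a) auto
      then have "real (a + 1) \<le> real (2 ^ a)"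
        by (simp only: of_nat_le_iff)
      then show ?thesis by simp
    qed
    ultimately show ?thesis by linarith
  qed
  have small: "real a + 1 \<le> c * (real p ^ a) powr \<epsilon>" if "prime p" for p a
  proof -
    have p: "real p \<ge> 2"
      using prime_ge_2_nat[OF that] by simp
    have "real a + 1 \<le> c * (1 + \<epsilon> * ln 2 * real a)"
      using assms by (simp add: c_def field_simps)
    also have "1 + \<epsilon> * ln 2 * real a \<le> exp (\<epsilon> * ln 2 * real a)"
      by (rule exp_ge_add_one_self)
    also have "\<dots> = (2 ^ a) powr \<epsilon>"
      by (simp add: powr_def ln_realpow mult_ac)
    also have "\<dots> \<le> (real p ^ a) powr \<epsilon>"
      using p assms by (intro powr_mono2 power_mono) auto
    finally show ?thesis
      using c1 by simp
  qed
  have fin: "finite {p. prime p \<and> p dvd n \<and> p < P}" for n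
    by (rule finite_subset[of _ "{..<P}"]) auto
  have main: "real (card {d. d dvd n}) \<le> c ^ w n * real n powr \<epsilon>" if "n > 0" for n :: nat
    using that
  proof (induction n rule: less_induct)
    case (less n)
    show ?case
    proof (cases "n = 1")
      case True
      then show ?thesis
        using c1 by (simp add: one_le_power)
    next
      case False
      then obtain p where p: "prime p" "p dvd n"
        using prime_factor_nat by blast
      obtain m where m: "n = p ^ multiplicity p n * m" "\<not> p dvd m"
        using multiplicity_decompose'[of n p] less.prems p(1) by (metis not_prime_unit not_less0)
      define a where "a = multiplicity p n"
      have a: "a > 0"
        unfolding a_def using p less.prems by (simp add: prime_multiplicity_gt_zero_iff)
      have nm: "n = p ^ a * m"
        using m(1) by (simp add: a_def)
      have m0: "m > 0"
        using nm less.prems by (cases m) auto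
      have p2: "p \<ge> 2"
        using p(1) by (rule prime_ge_2_nat)
      have pa: "p ^ a > 1"
        using p2 a one_less_power[of p a] by simp
      then have mn: "m < n"
        using nm m0 by simp
      have "card {d. d dvd n} \<le> card {d. d dvd p ^ a} * card {d. d dvd m}"
        unfolding nm using p2 m0 by (intro card_divisors_mult_le) auto
      also have "\<dots> \<le> (a + 1) * card {d. d dvd m}"
        using card_divisors_prime_power_le[OF p(1)] by (rule mult_le_mono1)
      finally have "real (card {d. d dvd n}) \<le> real ((a + 1) * card {d. d dvd m})"
        by (simp only: of_nat_le_iff)
      also have "\<dots> = (real a + 1) * real (card {d. d dvd m})"
        by (simp add: algebra_simps)
      also have "\<dots> \<le> (real a + 1) * (c ^ w m * real m powr \<epsilon>)"
        using less.IH[OF mn m0] by (intro mult_left_mono) auto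
      also have "\<dots> \<le> c ^ w n * (real p ^ a) powr \<epsilon> * real m powr \<epsilon>"
      proof (cases "p < P")
        case True
        have sub: "{q. prime q \<and> q dvd m \<and> q < P} \<union> {p} \<subseteq> {q. prime q \<and> q dvd n \<and> q < P}"
          using p True nm by auto
        have "w m + 1 = card ({q. prime q \<and> q dvd m \<and> q < P} \<union> {p})"
          using m(2) fin[of m] by (simp add: w_def)
        also have "\<dots> \<le> w n"
          unfolding w_def using sub fin[of n] by (intro card_mono)
        finally have "w m + 1 \<le> w n" .
        have "(real a + 1) * (c ^ w m * real m powr \<epsilon>)
            \<le> (c * (real p ^ a) powr \<epsilon>) * (c ^ w m * real m powr \<epsilon>)"
          using small[OF p(1), of a] c1 by (intro mult_right_mono) auto
        also have "\<dots> = c ^ (w m + 1) * (real p ^ a) powr \<epsilon> * real m powr \<epsilon>"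
          by simp
        also have "\<dots> \<le> c ^ w n * (real p ^ a) powr \<epsilon> * real m powr \<epsilon>"
          using \<open>w m + 1 \<le> w n\<close> c1 by (intro mult_right_mono power_increasing) auto
        finally show ?thesis .
      next
        case False
        have "w m \<le> w n"
          unfolding w_def using fin[of n] nm by (intro card_mono) auto
        have "(real a + 1) * (c ^ w m * real m powr \<epsilon>)
            \<le> (real p ^ a) powr \<epsilon> * (c ^ w m * real m powr \<epsilon>)"
          using large[of p a] False c1 by (intro mult_right_mono) auto
        also have "\<dots> = c ^ w m * (real p ^ a) powr \<epsilon> * real m powr \<epsilon>"
          by simp
        also have "\<dots> \<le> c ^ w n * (real p ^ a) powr \<epsilon> * real m powr \<epsilon>"
          using \<open>w m \<le> w n\<close> c1 by (intro mult_right_mono power_increasing) auto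
        finally show ?thesis .
      qed
      also have "\<dots> = c ^ w n * real n powr \<epsilon>"
        unfolding nm by (simp add: powr_mult)
      finally show ?thesis .
    qed
  qed
  have "real (card {d. d dvd n}) \<le> c ^ P * real n powr \<epsilon>" if "n > 0" for n :: nat
  proof -
    have "w n \<le> card {..<P}"
      unfolding w_def by (intro card_mono) auto
    then have "c ^ w n * real n powr \<epsilon> \<le> c ^ P * real n powr \<epsilon>"
      using c1 by (intro mult_right_mono power_increasing) auto
    with main[OF that] show ?thesis by linarith
  qed
  moreover have "c ^ P \<ge> 1"
    using c1 by (rule one_le_power)
  ultimately show ?thesis
    using that by blast
qed

lemma card_pos_divisors: "n > 0 \<Longrightarrow> card (pos_divisors n) = card {d. d dvd nat n}"
proof -
  assume n: "n > 0"
  have "pos_divisors n = int ` {d. d dvd nat n}"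
  proof
    show "pos_divisors n \<subseteq> int ` {d. d dvd nat n}"
    proof
      fix d assume d: "d \<in> pos_divisors n"
      then have "d = int (nat d)" "nat d dvd nat n"
        using n by (auto simp: pos_divisors_def nat_dvd_iff)
      then show "d \<in> int ` {d. d dvd nat n}" by blast
    qed
    show "int ` {d. d dvd nat n} \<subseteq> pos_divisors n"
    proof
      fix x assume "x \<in> int ` {d. d dvd nat n}"
      then obtain d where d: "x = int d" "d dvd nat n" by blast
      then have "d > 0"
        using n by (cases d) auto
      moreover have "int d dvd int (nat n)"
        using d(2) by (simp only: int_dvd_int_iff)
      ultimately show "x \<in> pos_divisors n"
        using n d(1) by (simp add: pos_divisors_def)
    qed
  qed
  then show ?thesis
    by (simp add: card_image)
qed

section \<open>The total number of close pairs\<close>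

lemma card_close_pairs:
  fixes T :: nat and L :: int
  assumes L: "L \<ge> 1"
    and T: "\<And>n. 0 < n \<Longrightarrow> n \<le> 16 * L ^ 3 \<Longrightarrow> card (pos_divisors n) \<le> T"
  defines "c \<equiv> 6561 * 36 * 4 * 6561 * 48 :: real"
  shows "finite (close_pairs L)"
    "real (card (close_pairs L)) \<le> c * real T ^ 5 * L * (1 + ln (4 * real_of_int L)) ^ 3"
proof -
  \<comment> \<open>All norms of u and v are at most this integer cube root, and the M^3 of the
    summation becomes a single factor L.\<close>
  define M where "M = \<lfloor>root 3 (real_of_int L)\<rfloor>"
  have root: "root 3 (real_of_int L) ^ 3 = real_of_int L"
    using L by (intro real_root_pow_pos2) auto
  have M1: "M \<ge> 1"
    using L unfolding M_def by (simp add: le_floor_iff)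
  have "real_of_int M \<le> root 3 (real_of_int L)"
    unfolding M_def by linarith
  then have "real_of_int M ^ 3 \<le> real_of_int L"
    using M1 power_mono[of "real_of_int M" "root 3 (real_of_int L)" 3] by (simp add: root)
  then have M3: "M ^ 3 \<le> L"
    by (metis of_int_le_iff of_int_power)
  have le_M: "k \<le> M" if "k ^ 3 < L" for k :: int
  proof -
    have "real_of_int (k ^ 3) < root 3 (real_of_int L) ^ 3"
      using that unfolding root by (simp only: of_int_less_iff)
    then have "real_of_int k < root 3 (real_of_int L)"
      using L power_less_imp_less_base[of "real_of_int k" 3] by simp
    then show ?thesis
      unfolding M_def by linarith
  qed
  have M2: "M\<^sup>2 \<le> M ^ 3" "M \<le> M ^ 3"
    using M1 by (auto intro: power_increasing self_le_power)
  have L3: "L \<le> L ^ 3"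
    using L by (auto intro: self_le_power)
  \<comment> \<open>K p carries T^4: T^2 from the pairs (g, a) and T^2 from the bound for four
    squares. The summation over p adds the fifth T and the factor 48.\<close>
  define K where "K p = (case p of (k, l, m, e) \<Rightarrow>
    T * (T * nat (max_square_root (16 * ((k * l - m\<^sup>2) div e\<^sup>2))) * 6561) *
      (nat (9 * (4 * (gcd k (gcd m e))\<^sup>2)) * (T * (T * 4 * 6561))))" for p
  have sub: "close_pair_params ` close_pairs L \<subseteq> gram_params M"
  proof
    fix p assume "p \<in> close_pair_params ` close_pairs L"
    then obtain x u v where t: "(x, u, v) \<in> close_pairs L" "p = close_pair_params (x, u, v)"
      by auto
    have pos: "qnorm u * qnorm v - (qinner u v)\<^sup>2 > 0"
      by (rule close_pairs_gram_pos[OF t(1)])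
    define \<gamma> where "\<gamma> = qim (qcnj u * v)"
    have norm: "qnorm \<gamma> = qnorm u * qnorm v - (qinner u v)\<^sup>2"
      by (simp add: \<gamma>_def qnorm_qim qnorm_mult qre_qcnj_mult)
    then have "\<gamma> \<noteq> 0"
      using pos by (metis less_irrefl qnorm_eq_0)
    then obtain q where q: "\<gamma> = of_int (qcontent \<gamma>) * q"
      using primitive_part by blast
    have "qnorm \<gamma> = (qcontent \<gamma>)\<^sup>2 * qnorm q"
      by (subst q) (simp add: qnorm_mult)
    then have "(qcontent \<gamma>)\<^sup>2 dvd qnorm u * qnorm v - (qinner u v)\<^sup>2"
      unfolding norm[symmetric] by simp
    moreover have "qcontent \<gamma> \<ge> 1"
      using \<open>\<gamma> \<noteq> 0\<close> qcontent_nonneg[of \<gamma>] qcontent_eq_0[of \<gamma>] by linarith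
    moreover have "qnorm u > 0" "qnorm v > 0"
      using t(1) by (simp_all add: close_pairs_def)
    then have "qnorm u \<ge> 1" "qnorm v \<ge> 1"
      by linarith+
    moreover have "qnorm u ^ 3 < L" "qnorm v ^ 3 < L"
      using t(1) by (simp_all add: close_pairs_def)
    ultimately show "p \<in> gram_params M"
      using pos le_M unfolding t(2) close_pair_params_def gram_params_def \<gamma>_def by auto
  qed
  have fib: "finite {t \<in> close_pairs L. close_pair_params t = p} \<and>
      card {t \<in> close_pairs L. close_pair_params t = p} \<le> K p" if p: "p \<in> gram_params M" for p
  proof -
    obtain k l m e where p': "p = (k, l, m, e)"
      by (cases p)
    define n where "n = 16 * ((k * l - m\<^sup>2) div e\<^sup>2)"
    have n: "n > 0"
      using gram_params_bounds(4)[OF p[unfolded p']] by (simp add: n_def)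
    have "g \<le> int (nat (max_square_root n))" if "g > 0" "g\<^sup>2 dvd n" for g
      using max_square_root(3)[OF n that] by simp
    from card_close_pairs_fiber[OF T, of L k l m e "nat (max_square_root n)", folded n_def, OF _ _ this]
    show ?thesis
      unfolding K_def p' by (simp add: n_def)
  qed
  note bound = card_le_sum_fibers[OF finite_gram_params sub fib]
  show "finite (close_pairs L)"
    by (rule bound(1))
  define W where "W p = (case p of (k, l, m, d) \<Rightarrow>
      real_of_int (max_square_root (16 * ((k * l - m\<^sup>2) div d\<^sup>2)) * (gcd k (gcd m d))\<^sup>2))"
    for p :: "int \<times> int \<times> int \<times> int"
  have KW: "real (K p) = 6561 * 36 * 4 * 6561 * real T ^ 4 * W p" if p: "p \<in> gram_params M" for p
  proof -
    obtain k l m e where p': "p = (k, l, m, e)"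
      by (cases p)
    have "max_square_root (16 * ((k * l - m\<^sup>2) div e\<^sup>2)) > 0"
      using gram_params_bounds(4)[OF p[unfolded p']] by (intro max_square_root) simp
    then show ?thesis
      by (simp add: p' K_def W_def power4_eq_xxxx)
  qed
  have "real (card (close_pairs L)) \<le> (\<Sum>p\<in>gram_params M. real (K p))"
    using bound(2) by (metis of_nat_le_iff of_nat_sum)
  also have "\<dots> = 6561 * 36 * 4 * 6561 * real T ^ 4 * (\<Sum>p\<in>gram_params M. W p)"
    by (simp add: KW sum_distrib_left)
  also have "\<dots> \<le> 6561 * 36 * 4 * 6561 * real T ^ 4 *
      (48 * real T * real_of_int M ^ 3 * (1 + ln (4 * real_of_int M)) ^ 3)"
  proof (rule mult_left_mono)
    show "(\<Sum>p\<in>gram_params M. W p)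
        \<le> 48 * real T * real_of_int M ^ 3 * (1 + ln (4 * real_of_int M)) ^ 3"
      unfolding W_def
    proof (rule sum_gram_params_le[OF _ M1])
      show "card (pos_divisors n) \<le> T" if "0 < n" "n \<le> 16 * M\<^sup>2" for n
        using that M2 M3 L3 by (intro T) linarith+
    qed
  qed simp
  also have "\<dots> \<le> 6561 * 36 * 4 * 6561 * real T ^ 4 *
      (48 * real T * real_of_int L * (1 + ln (4 * real_of_int L)) ^ 3)"
  proof -
    have "real_of_int M ^ 3 \<le> real_of_int L"
      by fact
    moreover have "M \<le> L"
      using M2 M3 by linarith
    then have "1 + ln (4 * real_of_int M) \<le> 1 + ln (4 * real_of_int L)"
      using M1 by simp
    moreover have "0 \<le> 1 + ln (4 * real_of_int M)"
      using M1 by (intro add_nonneg_nonneg) auto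
    ultimately show ?thesis
      using M1 L by (intro mult_left_mono mult_mono power_mono) auto
  qed
  also have "\<dots> = c * real T ^ 5 * L * (1 + ln (4 * real_of_int L)) ^ 3"
    by (simp add: c_def power_numeral_reduce)
  finally show "real (card (close_pairs L)) \<le> c * real T ^ 5 * L * (1 + ln (4 * real_of_int L)) ^ 3" .
qed

section \<open>Close triples\<close>

text \<open>The floor only serves to reach integer coefficients; on \<open>int_vectors\<close> it is
  exact.\<close>

definition quat_of_vec :: "real ^ 4 \<Rightarrow> quat" where
  "quat_of_vec x = Quat \<lfloor>x $ 1\<rfloor> \<lfloor>x $ 2\<rfloor> \<lfloor>x $ 3\<rfloor> \<lfloor>x $ 4\<rfloor>"

lemma quat_of_vec_components:
  assumes "x \<in> int_vectors"
  shows "x $ 1 = real_of_int (qre (quat_of_vec x))" "x $ 2 = real_of_int (qi (quat_of_vec x))"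
    "x $ 3 = real_of_int (qj (quat_of_vec x))" "x $ 4 = real_of_int (qk (quat_of_vec x))"
proof -
  have floor: "real_of_int \<lfloor>x $ i\<rfloor> = x $ i" for i
    using assms unfolding int_vectors_def by (metis Ints_cases floor_of_int mem_Collect_eq)
  show "x $ 1 = real_of_int (qre (quat_of_vec x))" "x $ 2 = real_of_int (qi (quat_of_vec x))"
    "x $ 3 = real_of_int (qj (quat_of_vec x))" "x $ 4 = real_of_int (qk (quat_of_vec x))"
    by (simp_all only: quat_of_vec_def quat.sel floor)
qed

lemma inj_on_quat_of_vec: "inj_on quat_of_vec int_vectors"
proof (rule inj_onI)
  fix x y :: "real ^ 4" assume xy: "x \<in> int_vectors" "y \<in> int_vectors" "quat_of_vec x = quat_of_vec y"
  show "x = y"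
    unfolding vec_eq_iff forall_4
    using quat_of_vec_components[OF xy(1)] quat_of_vec_components[OF xy(2)] xy(3) by simp
qed

lemma qnorm_quat_of_vec:
  assumes "x \<in> int_vectors"
  shows "real_of_int (qnorm (quat_of_vec x)) = (norm x)\<^sup>2"
  using quat_of_vec_components[OF assms] unfolding power2_norm_eq_inner
  by (simp add: qnorm_def inner_vec_def sum_4 power2_eq_square)

lemma qnorm_quat_of_vec_diff:
  assumes "x \<in> int_vectors" "y \<in> int_vectors"
  shows "real_of_int (qnorm (quat_of_vec x - quat_of_vec y)) = (norm (x - y))\<^sup>2"
  using quat_of_vec_components[OF assms(1)] quat_of_vec_components[OF assms(2)]
  unfolding power2_norm_eq_inner
  by (simp add: qnorm_def inner_vec_def sum_4 power2_eq_square)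

text \<open>A point of the sphere is its own neighbour, because the points of a close triple may
  coincide.\<close>

definition neighbours :: "int \<Rightarrow> quat \<Rightarrow> quat set" where
  "neighbours L a = {b. qnorm b = L \<and> qnorm (b - a) ^ 3 < L}"

lemma card_close_triples_le_neighbours:
  assumes "L \<ge> 1"
  shows "card (close_triples L) \<le> (\<Sum>a\<in>{q. qnorm q = L}. (card (neighbours L a))\<^sup>2)"
proof -
  define f where "f x = (quat_of_vec (x $ 1), quat_of_vec (x $ 2), quat_of_vec (x $ 3))"
    for x :: "real ^ 4 ^ 3"
  have fin: "finite (neighbours L a)" for a
    unfolding neighbours_def using finite_qnorm[of L] by (rule rev_finite_subset) auto
  have inj: "inj_on f (close_triples L)"
  proof (rule inj_onI)
    fix x y assume xy: "x \<in> close_triples L" "y \<in> close_triples L" "f x = f y"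
    then have "x $ i \<in> int_vectors" "y $ i \<in> int_vectors" for i
      by (auto simp: close_triples_def)
    then have "x $ i = y $ i" if "quat_of_vec (x $ i) = quat_of_vec (y $ i)" for i
      using that inj_onD[OF inj_on_quat_of_vec] by blast
    then show "x = y"
      using xy(3) unfolding vec_eq_iff[of x y] forall_3 f_def by simp
  qed
  \<comment> \<open>Raised to the sixth power, the condition on the real norm becomes an inequality
    between integers.\<close>
  have close: "qnorm (quat_of_vec x - quat_of_vec y) ^ 3 < L"
    if "x \<in> int_vectors" "y \<in> int_vectors" "norm (x - y) < of_int L powr (1 / 6)" for x y
  proof -
    have "norm (x - y) ^ 6 < (of_int L powr (1 / 6)) ^ 6"
      using that by (intro power_strict_mono) auto
    also have "\<dots> = of_int L"
      using assms by (simp add: powr_realpow[symmetric] powr_powr)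
    finally have "((norm (x - y))\<^sup>2) ^ 3 < of_int L"
      by (simp add: power_mult[symmetric])
    then have "real_of_int (qnorm (quat_of_vec x - quat_of_vec y) ^ 3) < of_int L"
      using qnorm_quat_of_vec_diff[OF that(1,2)] by simp
    then show ?thesis
      by (simp only: of_int_less_iff)
  qed
  have "f ` close_triples L \<subseteq> (SIGMA a:{q. qnorm q = L}. neighbours L a \<times> neighbours L a)"
  proof
    fix p assume "p \<in> f ` close_triples L"
    then obtain x where x: "x \<in> close_triples L" "p = f x" by blast
    have int: "x $ i \<in> int_vectors" and nrm: "(norm (x $ i))\<^sup>2 = of_int L"
      and dist: "i \<noteq> j \<Longrightarrow> norm (x $ i - x $ j) < of_int L powr (1 / 6)" for i j
      using x(1) by (auto simp: close_triples_def)
    have "qnorm (quat_of_vec (x $ i)) = L" for i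
      using qnorm_quat_of_vec[OF int, of i] nrm[of i] by simp
    moreover have "qnorm (quat_of_vec (x $ i) - quat_of_vec (x $ j)) ^ 3 < L" if "i \<noteq> j" for i j
      by (rule close[OF int int dist[OF that]])
    ultimately show "p \<in> (SIGMA a:{q. qnorm q = L}. neighbours L a \<times> neighbours L a)"
      by (simp add: x(2) f_def neighbours_def)
  qed
  moreover have "finite (SIGMA a:{q. qnorm q = L}. neighbours L a \<times> neighbours L a)"
    using fin finite_qnorm by blast
  ultimately have "card (close_triples L)
      \<le> card (SIGMA a:{q. qnorm q = L}. neighbours L a \<times> neighbours L a)"
    using card_inj_on_le[OF inj] by blast
  also have "\<dots> = (\<Sum>a\<in>{q. qnorm q = L}. (card (neighbours L a))\<^sup>2)"
    using fin finite_qnorm[of L] by (subst card_SigmaI) (auto simp: card_cartesian_product power2_eq_square)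
  finally show ?thesis .
qed

text \<open>With n neighbours of a, itself included, (n - 1) (n - 2) counts the ordered pairs of
  distinct other ones. Truncated subtraction is harmless: n >= 1, and at n = 1 the first factor is
  0.\<close>

lemma sum_neighbours_le_card_close_pairs:
  assumes "L \<ge> 1" "finite (close_pairs L)"
  shows "(\<Sum>a\<in>{q. qnorm q = L}. (card (neighbours L a) - 1) * (card (neighbours L a) - 2))
    \<le> card (close_pairs L)"
proof -
  have fin: "finite (neighbours L a)" for a
    unfolding neighbours_def using finite_qnorm[of L] by (rule rev_finite_subset) auto
  define D where "D a = {(b, c). b \<in> neighbours L a - {a} \<and> c \<in> neighbours L a - {a} \<and> b \<noteq> c}" for a
  have cardD: "card (D a) = (card (neighbours L a) - 1) * (card (neighbours L a) - 2)"
    and finD: "finite (D a)" if a: "qnorm a = L" for a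
  proof -
    define B where "B = neighbours L a - {a}"
    have "a \<in> neighbours L a"
      using a assms(1) by (simp add: neighbours_def)
    then have B: "finite B" "card B = card (neighbours L a) - 1"
      using fin[of a] by (simp_all add: B_def card_Diff_singleton)
    have D: "D a = B \<times> B - (\<lambda>b. (b, b)) ` B"
      by (auto simp: D_def B_def)
    then show "finite (D a)"
      using B by simp
    have "card ((\<lambda>b. (b, b)) ` B) = card B"
      by (intro card_image inj_onI) simp
    then have "card (D a) = card B * card B - card B"
      unfolding D using B by (subst card_Diff_subset) (auto simp: card_cartesian_product)
    also have "\<dots> = card B * (card B - 1)"
      by (simp add: diff_mult_distrib2)
    finally show "card (D a) = (card (neighbours L a) - 1) * (card (neighbours L a) - 2)"
      by (simp add: B(2) numeral_2_eq_2)
  qed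
  define f where "f p = (case p of (a, b, c) \<Rightarrow> (a, b - a, c - a))" for p :: "quat \<times> quat \<times> quat"
  have "f ` (SIGMA a:{q. qnorm q = L}. D a) \<subseteq> close_pairs L"
  proof
    fix p assume "p \<in> f ` (SIGMA a:{q. qnorm q = L}. D a)"
    then obtain a b c where *: "L = qnorm a" "(b, c) \<in> D a" and p: "p = f (a, b, c)"
      by auto
    have inner: "2 * qinner a (x - a) = - qnorm (x - a)" if "qnorm x = qnorm a" for x
      using that by (simp add: quat_components algebra_simps)
    show "p \<in> close_pairs L"
      unfolding p using * inner by (auto simp: f_def close_pairs_def D_def neighbours_def)
  qed
  moreover have "inj_on f (SIGMA a:{q. qnorm q = L}. D a)"
    by (rule inj_onI) (auto simp: f_def)
  ultimately have "card (SIGMA a:{q. qnorm q = L}. D a) \<le> card (close_pairs L)"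
    using assms(2) by (intro card_inj_on_le)
  also have "card (SIGMA a:{q. qnorm q = L}. D a)
      = (\<Sum>a\<in>{q. qnorm q = L}. (card (neighbours L a) - 1) * (card (neighbours L a) - 2))"
    using finite_qnorm[of L] finD cardD by (subst card_SigmaI) auto
  finally show ?thesis .
qed

lemma card_close_triples_le:
  assumes "L \<ge> 1" "finite (close_pairs L)"
  shows "card (close_triples L) \<le> 4 * card {q. qnorm q = L} + 4 * card (close_pairs L)"
proof -
  \<comment> \<open>Equality holds at n = 2, where a point has a single other neighbour and yields
    no close pair. This forces the additive 4 for each point of the sphere, which the bound for four
    squares affords.\<close>
  have sq: "n\<^sup>2 \<le> 4 + 4 * ((n - 1) * (n - 2))" for n :: nat
  proof (cases "n \<ge> 2")
    case True
    then obtain m where m: "n = m + 2"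
      by (metis add.commute le_Suc_ex)
    show ?thesis
      unfolding m by (simp add: power2_eq_square algebra_simps)
  next
    case False
    then have "n = 0 \<or> n = 1" by linarith
    then show ?thesis by auto
  qed
  have "(\<Sum>a\<in>{q. qnorm q = L}. (card (neighbours L a))\<^sup>2)
      \<le> (\<Sum>a\<in>{q. qnorm q = L}. 4 + 4 * ((card (neighbours L a) - 1) * (card (neighbours L a) - 2)))"
    by (intro sum_mono sq)
  also have "\<dots> = 4 * card {q. qnorm q = L} +
      4 * (\<Sum>a\<in>{q. qnorm q = L}. (card (neighbours L a) - 1) * (card (neighbours L a) - 2))"
    by (simp add: sum.distrib sum_distrib_left)
  finally show ?thesis
    using card_close_triples_le_neighbours[OF assms(1)] sum_neighbours_le_card_close_pairs[OF assms]
    by linarith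
qed

theorem mainTheorem3:
  fixes \<epsilon> :: real
  assumes "\<epsilon> > 0"
  shows "\<exists>C :: real. \<forall>L :: int. L \<ge> 1 \<longrightarrow>
           real (card (close_triples L)) \<le> C * of_int L powr (1 + \<epsilon>)"
proof -
  \<comment> \<open>T is of size L^(3 \<delta>), as divisors are counted for numbers up to 16 L^3.
    So T^5 contributes 15 \<delta> and the three logarithms 3 \<delta>, together \<epsilon>.\<close>
  define \<delta> where "\<delta> = \<epsilon> / 18"
  have \<delta>: "\<delta> > 0"
    using assms by (simp add: \<delta>_def)
  obtain C where C: "C \<ge> 1"
    "\<And>n :: nat. n > 0 \<Longrightarrow> real (card {d. d dvd n}) \<le> C * real n powr \<delta>"
    using divisor_bound_nat[OF \<delta>] by blast
  define c :: real where "c = 6561 * 36 * 4 * 6561 * 48"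
  \<comment> \<open>Four times the constant 9 * 4 * 6561 of the bound for four squares.\<close>
  define c' :: real where "c' = 36 * 26244"
  define A where "A = C * 16 powr \<delta>"
  \<comment> \<open>Chosen so that 1 + ln (4 x) <= B x^\<delta>, by way of ln x <= x^\<delta> /
    \<delta>.\<close>
  define B where "B = 1 + ln 4 + 1 / \<delta>"
  have B1: "B \<ge> 1"
    using \<delta> by (simp add: B_def)
  show ?thesis
  proof (intro exI[of _ "(c' + 4 * c) * A ^ 5 * B ^ 3"] allI impI)
    fix L :: int assume L: "L \<ge> 1"
    define x where "x = real_of_int L"
    have x: "x \<ge> 1"
      using L by (simp add: x_def)
    define T where "T = nat \<lfloor>A * x powr (3 * \<delta>)\<rfloor>"
    have A1: "A \<ge> 1"
    proof -
      have "1 * 1 \<le> C * 16 powr \<delta>"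
        using C(1) \<delta> by (intro mult_mono ge_one_powr_ge_zero) auto
      then show ?thesis by (simp add: A_def)
    qed
    have xp: "x powr a \<ge> 1" if "a \<ge> 0" for a
      using x that by (rule ge_one_powr_ge_zero)
    have Ax: "A * x powr (3 * \<delta>) \<ge> 1"
      using mult_mono[OF A1 xp[of "3 * \<delta>"]] \<delta> A1 by simp
    have T_le: "real T \<le> A * x powr (3 * \<delta>)"
      using Ax unfolding T_def by simp
    have T1: "real T \<ge> 1"
      using Ax unfolding T_def by (simp add: le_nat_iff le_floor_iff)
    have T: "card (pos_divisors n) \<le> T" if n: "0 < n" "n \<le> 16 * L ^ 3" for n
    proof -
      have "real_of_int n \<le> real_of_int (16 * L ^ 3)"
        using n by (simp only: of_int_le_iff)
      then have nx: "real (nat n) \<le> 16 * x ^ 3"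
        using n by (simp add: x_def)
      have "real (card (pos_divisors n)) \<le> C * real (nat n) powr \<delta>"
        using C(2)[of "nat n"] n by (simp add: card_pos_divisors)
      also have "\<dots> \<le> C * (16 * x ^ 3) powr \<delta>"
        using C(1) \<delta> nx by (intro mult_left_mono powr_mono2) auto
      also have "(16 * x ^ 3) powr \<delta> = 16 powr \<delta> * x powr (3 * \<delta>)"
        using x powr_powr[of x 3 \<delta>] by (simp add: powr_mult)
      also have "C * (16 powr \<delta> * x powr (3 * \<delta>)) = A * x powr (3 * \<delta>)"
        by (simp add: A_def)
      finally show ?thesis
        unfolding T_def by (rule le_nat_floor)
    qed
    define H where "H = 1 + ln (4 * x)"
    have H1: "H \<ge> 1"
      using x by (simp add: H_def)
    have "H = 1 + ln 4 + ln x"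
      using x by (simp add: H_def ln_mult)
    also have "\<dots> \<le> (1 + ln 4) * x powr \<delta> + x powr \<delta> / \<delta>"
    proof (rule add_mono)
      have "(1 + ln 4) * 1 \<le> (1 + ln 4) * x powr \<delta>"
        using xp[of \<delta>] \<delta> by (intro mult_left_mono add_nonneg_nonneg) auto
      then show "1 + ln 4 \<le> (1 + ln 4) * x powr \<delta>"
        by simp
      show "ln x \<le> x powr \<delta> / \<delta>"
        by (rule ln_powr_bound[OF x \<delta>])
    qed
    also have "\<dots> = B * x powr \<delta>"
      by (simp add: B_def field_simps)
    finally have HB: "H \<le> B * x powr \<delta>" .
    have "finite (close_pairs L)"
      and pairs: "real (card (close_pairs L)) \<le> c * real T ^ 5 * x * H ^ 3"
      unfolding c_def H_def x_def by (rule card_close_pairs[OF L T]; assumption)+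
    then have "card (close_triples L) \<le> 4 * card {q. qnorm q = L} + 4 * card (close_pairs L)"
      using card_close_triples_le[OF L] by blast
    then have "real (card (close_triples L))
        \<le> real (4 * card {q. qnorm q = L} + 4 * card (close_pairs L))"
      by (simp only: of_nat_le_iff)
    also have "\<dots> = 4 * real (card {q. qnorm q = L}) + 4 * real (card (close_pairs L))"
      by simp
    also have "\<dots> \<le> c' * real T ^ 5 * x * H ^ 3 + 4 * (c * real T ^ 5 * x * H ^ 3)"
    proof (intro add_mono mult_left_mono pairs)
      have "L \<le> 16 * L ^ 3"
        using self_le_power[of L 3] L by simp
      then have "card {q. qnorm q = L} \<le> nat (9 * L) * (T * (T * 4 * 6561))"
        using L T by (intro card_sum_four_squares) auto
      then have "real (card {q. qnorm q = L}) \<le> real (nat (9 * L) * (T * (T * 4 * 6561)))"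
        by (simp only: of_nat_le_iff)
      also have "\<dots> = 9 * 26244 * real T ^ 2 * x * 1"
        using L by (simp add: x_def power2_eq_square)
      \<comment> \<open>The bound for the sphere is inflated to the shape of the bound for close
        pairs, so that the two can be added.\<close>
      also have "\<dots> \<le> 9 * 26244 * real T ^ 5 * x * H ^ 3"
        using T1 x H1 by (intro mult_mono power_increasing one_le_power) auto
      finally show "4 * real (card {q. qnorm q = L}) \<le> c' * real T ^ 5 * x * H ^ 3"
        unfolding c'_def by linarith
    qed simp
    also have "\<dots> = (c' + 4 * c) * (real T ^ 5 * x * H ^ 3)"
      by (simp add: algebra_simps)
    also have "\<dots> \<le> (c' + 4 * c) * ((A * x powr (3 * \<delta>)) ^ 5 * x * (B * x powr \<delta>) ^ 3)"
      using T_le HB x H1 T1 A1 B1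
      by (intro mult_left_mono mult_mono power_mono) (auto simp: c_def c'_def)
    also have "\<dots> = (c' + 4 * c) * A ^ 5 * B ^ 3 * ((x powr (3 * \<delta>)) ^ 5 * x powr 1 * (x powr \<delta>) ^ 3)"
      using x by (simp add: power_mult_distrib)
    also have "(x powr (3 * \<delta>)) ^ 5 * x powr 1 * (x powr \<delta>) ^ 3 = x powr (1 + \<epsilon>)"
    proof -
      have "(x powr (3 * \<delta>)) ^ 5 = x powr (5 * (3 * \<delta>))" "(x powr \<delta>) ^ 3 = x powr (3 * \<delta>)"
        using x powr_realpow[of "x powr (3 * \<delta>)" 5] powr_realpow[of "x powr \<delta>" 3]
        by (simp_all add: powr_powr mult.commute)
      then have "(x powr (3 * \<delta>)) ^ 5 * x powr 1 * (x powr \<delta>) ^ 3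
          = x powr (5 * (3 * \<delta>) + 1 + 3 * \<delta>)"
        by (simp only: powr_add)
      also have "5 * (3 * \<delta>) + 1 + 3 * \<delta> = 1 + \<epsilon>"
        by (simp add: \<delta>_def)
      finally show ?thesis .
    qed
    finally show "real (card (close_triples L)) \<le> (c' + 4 * c) * A ^ 5 * B ^ 3 * of_int L powr (1 + \<epsilon>)"
      by (simp only: x_def)
  qed
qed

end
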